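(* All of the following (the known) special families of cyclic coverings have no repeating factors in the monodromy. (a) The families of all $\mathbb{Z}/d\mathbb{Z}$-coverings of $\mathbb{P}^1$ with local monodromies $\Theta$, for $(d;\Theta)$ equal to one of: $(2;1,1,1,1)$, $(2;1,1,1,1,1,1)$, $(3;1,1,2,2)$, $(4;1,2,2,3)$, $(6;2,3,3,4)$, $(3;1,1,1,1,2)$, $(4;1,1,1,1)$, $(4;1,1,2,2,2)$, $(6;1,3,4,4)$, $(3;1,1,1,1,1,1)$, $(5;1,3,3,3)$, $(6;1,1,1,3)$, $(6;1,1,2,2)$, $(6;2,2,2,3,3)$, $(8;2,4,5,5)$, $(5;2,2,2,2,2)$, $(7;2,4,4,4)$, $(10;3,5,6,6)$, $(9;3,5,5,5)$, $(12;4,6,7,7)$. (b) The families of all $\mathbb{Z}/d\mathbb{Z}$-coverings of genus $1$ curves with local monodromies $\Theta$, for $(d;\Theta)$ equal to one of: $(2;1,1)$, $(2;1,1,1,1)$, $(3;1,2)$, $(3;1,1,1)$, $(4;2,2)$.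
   Context: For $G=\mathbb{Z}/d\mathbb{Z}$, a connected $G$-covering $C\to C'$ of smooth projective complex curves with $g(C')=g'$ and $r$ branch points has local monodromies $\Theta=(\theta_1,\dots,\theta_r)$, where $\theta_i\in\mathbb{Z}/d\mathbb{Z}\setminus\{0\}$ and $\sum\theta_i=0$; it is given by an epimorphism from the fundamental group of the punctured curve $C'$ to $G$ sending the loop around the $i$-th branch point to $\theta_i$. For an irreducible complex character $\chi$ of $G$ let $m_\chi$ be the multiplicity of $\chi$ in $H^0(C,K_C)$, for $C$ any curve in the family, and $\bar\chi$ the conjugate character. The family has no repeating factors in the monodromy if for all nontrivial irreducible characters $\chi_i,\chi_j$ of $G$ with $\chi_j\notin\{\chi_i,\bar\chi_i\}$ and $m_{\chi_i}m_{\bar\chi_i}m_{\chi_j}m_{\bar\chi_j}\neq 0$: (i) $\operatorname{SU}(m_{\chi_i},m_{\bar\chi_i})\not\cong\operatorname{SU}(m_{\chi_j},m_{\bar\chi_j})$ if $\chi_i\neq\bar\chi_i$ and $\chi_j\neq\bar\chi_j$; (ii) $\operatorname{Sp}(2m_{\chi_i},\mathbb{R})\neq\operatorname{Sp}(2m_{\chi_j},\mathbb{R})$ if $\chi_i=\bar\chi_i$ and $\chi_j=\bar\chi_j$. *)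

theory Defs
  imports
    "HOL-Analysis.Analysis"
    "HOL-Algebra.Elementary_Groups"
    "HOL-Algebra.Group_Action"
    "HOL-Library.Function_Algebras"
    "Jordan_Normal_Form.Schur_Decomposition"
begin

section \<open>Smooth projective complex curves\<close>

text \<open>A chart is a pair (domain, coordinate function).  The atlas is not required to be
  maximal.\<close>

type_synonym 'a chart = "'a set \<times> ('a \<Rightarrow> complex)"

record 'a curve =
  curve_top :: "'a topology"
  atlas :: "'a chart set"

abbreviation points :: "'a curve \<Rightarrow> 'a set" where
  "points C \<equiv> topspace (curve_top C)"

abbreviation chart_inv :: "'a chart \<Rightarrow> complex \<Rightarrow> 'a" where
  "chart_inv c \<equiv> inv_into (fst c) (snd c)"

definition coord_expr :: "'a chart \<Rightarrow> ('a \<Rightarrow> 'b) \<Rightarrow> 'b chart \<Rightarrow> complex \<Rightarrow> complex" where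
  "coord_expr c f c' = snd c' \<circ> f \<circ> chart_inv c"

definition complex_chart :: "'a topology \<Rightarrow> 'a chart \<Rightarrow> bool" where
  "complex_chart X c \<longleftrightarrow>
     openin X (fst c) \<and> open (snd c ` fst c) \<and>
     homeomorphic_map (subtopology X (fst c)) (top_of_set (snd c ` fst c)) (snd c)"

definition compact_riemann_surface :: "'a curve \<Rightarrow> bool" where
  "compact_riemann_surface C \<longleftrightarrow>
     points C \<noteq> {} \<and> Hausdorff_space (curve_top C) \<and>
     compact_space (curve_top C) \<and> connected_space (curve_top C) \<and>
     (\<forall>c\<in>atlas C. complex_chart (curve_top C) c) \<and>
     (\<Union>c\<in>atlas C. fst c) = points C \<and>
     (\<forall>c\<in>atlas C. \<forall>c'\<in>atlas C.
        coord_expr c (\<lambda>x. x) c' holomorphic_on snd c ` (fst c \<inter> fst c'))"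

text \<open>\<open>F x\<close> is a vector of homogeneous coordinates of the image of \<open>x\<close> in projective
  \<open>N\<close>-space.  Its choice is arbitrary, so \<open>F\<close> itself need not even be continuous; only the
  quotients \<open>F x i / F x j\<close>, which are the coordinates on the \<open>j\<close>-th standard affine chart,
  are required to be holomorphic.  Since the source is compact, an injective holomorphic
  immersion is an embedding onto a closed submanifold.\<close>

definition projective_embedding :: "'a curve \<Rightarrow> nat \<Rightarrow> ('a \<Rightarrow> nat \<Rightarrow> complex) \<Rightarrow> bool" where
  "projective_embedding C N F \<longleftrightarrow>
     (\<forall>x\<in>points C. \<exists>j\<le>N. F x j \<noteq> 0) \<and>
     (\<forall>j\<le>N. openin (curve_top C) {x \<in> points C. F x j \<noteq> 0}) \<and>
     (\<forall>c\<in>atlas C. \<forall>j\<le>N. \<forall>i\<le>N.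
        (\<lambda>z. F (chart_inv c z) i / F (chart_inv c z) j)
          holomorphic_on snd c ` {x \<in> fst c. F x j \<noteq> 0}) \<and>
     (\<forall>x\<in>points C. \<forall>y\<in>points C. (\<exists>a. a \<noteq> 0 \<and> (\<forall>i\<le>N. F y i = a * F x i)) \<longrightarrow> x = y) \<and>
     (\<forall>c\<in>atlas C. \<forall>x\<in>fst c. \<forall>j\<le>N. F x j \<noteq> 0 \<longrightarrow>
        (\<exists>i\<le>N. deriv (\<lambda>z. F (chart_inv c z) i / F (chart_inv c z) j) (snd c x) \<noteq> 0))"

definition smooth_projective_curve :: "'a curve \<Rightarrow> bool" where
  "smooth_projective_curve C \<longleftrightarrow>
     compact_riemann_surface C \<and> (\<exists>N F. projective_embedding C N F)"

definition holomorphic_map :: "'a curve \<Rightarrow> 'b curve \<Rightarrow> ('a \<Rightarrow> 'b) \<Rightarrow> bool" where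
  "holomorphic_map C C' f \<longleftrightarrow>
     continuous_map (curve_top C) (curve_top C') f \<and>
     (\<forall>c\<in>atlas C. \<forall>c'\<in>atlas C'.
        coord_expr c f c' holomorphic_on snd c ` (fst c \<inter> f -` fst c'))"

definition projective_line :: "complex option curve" where
  "projective_line =
     \<lparr>curve_top = Alexandroff_compactification euclidean,
      atlas = {(range Some, the),
               (- {Some 0}, \<lambda>x. case x of None \<Rightarrow> 0 | Some z \<Rightarrow> 1 / z)}\<rparr>"


section \<open>Holomorphic differentials\<close>

text \<open>A differential is given by its coefficient functions: \<open>\<omega> c x\<close> is the coefficient at
  \<open>x\<close> with respect to the differential of the coordinate \<open>snd c\<close>.  Coefficients without
  meaning are set to 0, so that equality of differentials is equality of functions.\<close>

type_synonym 'a differential = "'a chart \<Rightarrow> 'a \<Rightarrow> complex"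

definition holomorphic_differentials :: "'a curve \<Rightarrow> 'a differential set" where
  "holomorphic_differentials C =
     {\<omega>. (\<forall>c x. c \<notin> atlas C \<or> x \<notin> fst c \<longrightarrow> \<omega> c x = 0) \<and>
         (\<forall>c\<in>atlas C. (\<lambda>z. \<omega> c (chart_inv c z)) holomorphic_on snd c ` fst c) \<and>
         (\<forall>c\<in>atlas C. \<forall>c'\<in>atlas C. \<forall>x\<in>fst c \<inter> fst c'.
            \<omega> c x = \<omega> c' x * deriv (coord_expr c (\<lambda>x. x) c') (snd c x))}"

definition scale_differential :: "complex \<Rightarrow> 'a differential \<Rightarrow> 'a differential" where
  "scale_differential a \<omega> = (\<lambda>c x. a * \<omega> c x)"

lemma vector_space_scale_differential: "vector_space scale_differential"
  by unfold_locales (auto simp: scale_differential_def fun_eq_iff algebra_simps)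

text \<open>The value does not depend on the chart chosen around \<open>h x\<close> when \<open>\<omega>\<close> is a holomorphic
  differential.\<close>

definition pullback_differential ::
    "'a curve \<Rightarrow> ('a \<Rightarrow> 'a) \<Rightarrow> 'a differential \<Rightarrow> 'a differential" where
  "pullback_differential C h \<omega> =
     (\<lambda>c x. if c \<in> atlas C \<and> x \<in> fst c
            then let c' = (SOME c'. c' \<in> atlas C \<and> h x \<in> fst c')
                 in \<omega> c' (h x) * deriv (coord_expr c h c') (snd c x)
            else 0)"

text \<open>This is the geometric genus, the dimension of the space of global sections of the canonical
  bundle.\<close>

definition genus :: "'a curve \<Rightarrow> nat" where
  "genus C = vector_space.dim scale_differential (holomorphic_differentials C)"


section \<open>Cyclic coverings and their local monodromies\<close>

definition complex_units :: "complex monoid" where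
  "complex_units = \<lparr>carrier = - {0}, monoid.mult = (*), one = 1\<rparr>"

text \<open>The cyclic group being abelian, its irreducible characters are the homomorphisms to the
  multiplicative group of the complex numbers.\<close>

definition irreducible_characters :: "nat \<Rightarrow> (int \<Rightarrow> complex) set" where
  "irreducible_characters d =
     hom (integer_mod_group d) complex_units \<inter> extensional (carrier (integer_mod_group d))"

definition trivial_character :: "nat \<Rightarrow> int \<Rightarrow> complex" where
  "trivial_character d = (\<lambda>g\<in>carrier (integer_mod_group d). 1)"

definition conj_character :: "nat \<Rightarrow> (int \<Rightarrow> complex) \<Rightarrow> int \<Rightarrow> complex" where
  "conj_character d \<psi> = (\<lambda>g\<in>carrier (integer_mod_group d). cnj (\<psi> g))"

text \<open>\<open>\<rho>\<close> is the action on the points of \<open>C\<close>.  A group element \<open>g\<close> acts on the differentials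
  by pullback along the inverse of \<open>g\<close>.  As \<open>\<psi>\<close> is one-dimensional, its multiplicity is
  the dimension of the \<open>\<psi>\<close>-eigenspace.\<close>

definition multiplicity_H0 ::
    "nat \<Rightarrow> 'a curve \<Rightarrow> (int \<Rightarrow> 'a \<Rightarrow> 'a) \<Rightarrow> (int \<Rightarrow> complex) \<Rightarrow> nat" where
  "multiplicity_H0 d C \<rho> \<psi> =
     vector_space.dim scale_differential
       {\<omega> \<in> holomorphic_differentials C. \<forall>g\<in>carrier (integer_mod_group d).
          pullback_differential C (\<rho> (inv\<^bsub>integer_mod_group d\<^esub> g)) \<omega> =
          scale_differential (\<psi> g) \<omega>}"

text \<open>The monodromy of the covering along a loop is the group element that maps the initial
  point of a lift of the loop to its end point; the group being abelian, it does not depend on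
  the lift.  The local monodromy at a branch point \<open>p\<close> is the monodromy along a small positively
  oriented circle around \<open>p\<close>; the list \<open>ps\<close> consists of all branch points.\<close>

definition local_monodromy ::
    "'a curve \<Rightarrow> (int \<Rightarrow> 'a \<Rightarrow> 'a) \<Rightarrow> 'b curve \<Rightarrow> ('a \<Rightarrow> 'b) \<Rightarrow> 'b list \<Rightarrow> 'b \<Rightarrow> int \<Rightarrow> bool" where
  "local_monodromy C \<rho> C' \<pi> ps p \<theta> \<longleftrightarrow>
     (\<forall>c\<in>atlas C'. \<forall>\<epsilon>>0. \<forall>\<gamma>.
        p \<in> fst c \<and> cball (snd c p) \<epsilon> \<subseteq> snd c ` fst c \<and>
        (\<forall>q\<in>set ps. q \<in> fst c \<and> snd c q \<in> cball (snd c p) \<epsilon> \<longrightarrow> q = p) \<and>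
        pathin (curve_top C) \<gamma> \<and>
        (\<forall>t\<in>{0..1}. \<pi> (\<gamma> t) = chart_inv c (snd c p + of_real \<epsilon> * cis (2 * pi * t))) \<longrightarrow>
        \<gamma> 1 = \<rho> \<theta> (\<gamma> 0))"

text \<open>The total space is connected since it is a smooth projective curve; this corresponds to the
  surjectivity of the monodromy homomorphism on the fundamental group of the punctured curve.
  The group acts freely off the fibres of the points in \<open>ps\<close>, and these are branch points because
  the local monodromies are nonzero.\<close>

definition cyclic_covering ::
    "nat \<Rightarrow> int list \<Rightarrow> 'a curve \<Rightarrow> (int \<Rightarrow> 'a \<Rightarrow> 'a) \<Rightarrow> 'b curve \<Rightarrow> ('a \<Rightarrow> 'b) \<Rightarrow> 'b list \<Rightarrow> bool"
    where
  "cyclic_covering d \<Theta> C \<rho> C' \<pi> ps \<longleftrightarrow>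
     smooth_projective_curve C \<and> smooth_projective_curve C' \<and>
     holomorphic_map C C' \<pi> \<and> \<pi> ` points C = points C' \<and>
     group_action (integer_mod_group d) (points C) \<rho> \<and>
     (\<forall>g\<in>carrier (integer_mod_group d). holomorphic_map C C (\<rho> g)) \<and>
     (\<forall>x\<in>points C. \<forall>y\<in>points C.
        \<pi> x = \<pi> y \<longleftrightarrow> (\<exists>g\<in>carrier (integer_mod_group d). y = \<rho> g x)) \<and>
     distinct ps \<and> set ps \<subseteq> points C' \<and> length ps = length \<Theta> \<and>
     set \<Theta> \<subseteq> carrier (integer_mod_group d) - {0} \<and> sum_list \<Theta> mod int d = 0 \<and>
     (\<forall>x\<in>points C. \<pi> x \<notin> set ps \<longrightarrow>
        (\<forall>g\<in>carrier (integer_mod_group d). \<rho> g x = x \<longrightarrow> g = 0)) \<and>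
     (\<forall>i<length \<Theta>. local_monodromy C \<rho> C' \<pi> ps (ps ! i) (\<Theta> ! i))"

text \<open>The members of a family are recorded as curves with group action; \<open>S\<close> is the set of the
  curves that are allowed as quotient.\<close>

definition covering_family ::
    "'b curve set \<Rightarrow> nat \<Rightarrow> int list \<Rightarrow> ('a curve \<times> (int \<Rightarrow> 'a \<Rightarrow> 'a)) set" where
  "covering_family S d \<Theta> = {(C, \<rho>). \<exists>C'\<in>S. \<exists>\<pi> ps. cyclic_covering d \<Theta> C \<rho> C' \<pi> ps}"

definition curves_of_genus :: "nat \<Rightarrow> 'b curve set" where
  "curves_of_genus g = {C. smooth_projective_curve C \<and> genus C = g}"


section \<open>The groups SU(p,q) and Sp(2m,R)\<close>

definition hermitian_form :: "nat \<Rightarrow> nat \<Rightarrow> complex mat" where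
  "hermitian_form p q =
     mat (p + q) (p + q) (\<lambda>(i, j). if i = j then (if i < p then 1 else - 1) else 0)"

definition SU :: "nat \<Rightarrow> nat \<Rightarrow> complex mat monoid" where
  "SU p q =
     \<lparr>carrier = {A \<in> carrier_mat (p + q) (p + q).
        mat_adjoint A * hermitian_form p q * A = hermitian_form p q \<and> Determinant.det A = 1},
      monoid.mult = (*), one = 1\<^sub>m (p + q)\<rparr>"

text \<open>The argument \<open>n = 2 m\<close> is the size of the matrices.\<close>

definition symplectic_form :: "nat \<Rightarrow> real mat" where
  "symplectic_form n =
     mat n n (\<lambda>(i, j). if j = i + n div 2 then 1 else if i = j + n div 2 then - 1 else 0)"

definition Sp_real :: "nat \<Rightarrow> real mat monoid" where
  "Sp_real n =
     \<lparr>carrier = {A \<in> carrier_mat n n.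
        transpose_mat A * symplectic_form n * A = symplectic_form n},
      monoid.mult = (*), one = 1\<^sub>m n\<rparr>"

definition matrix_group_topology :: "'k::real_normed_field mat monoid \<Rightarrow> 'k mat topology" where
  "matrix_group_topology G =
     pullback_topology (carrier G)
       (\<lambda>A (i, j). if i < dim_row A \<and> j < dim_col A then A $$ (i, j) else 0) euclidean"

text \<open>A homeomorphic group isomorphism of closed matrix groups is automatically an isomorphism of
  Lie groups.\<close>

definition lie_group_isomorphic ::
    "'k::real_normed_field mat monoid \<Rightarrow> 'l::real_normed_field mat monoid \<Rightarrow> bool" where
  "lie_group_isomorphic G H \<longleftrightarrow>
     (\<exists>h\<in>iso G H. homeomorphic_map (matrix_group_topology G) (matrix_group_topology H) h)"


section \<open>Repeating factors\<close>

definition no_repeating_factors ::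
    "nat \<Rightarrow> ('a curve \<times> (int \<Rightarrow> 'a \<Rightarrow> 'a)) set \<Rightarrow> bool" where
  "no_repeating_factors d \<F> \<longleftrightarrow>
     (\<forall>(C, \<rho>)\<in>\<F>. let m = multiplicity_H0 d C \<rho>; bar = conj_character d in
        \<forall>\<psi>1 \<in> irreducible_characters d - {trivial_character d}.
        \<forall>\<psi>2 \<in> irreducible_characters d - {trivial_character d}.
          \<psi>2 \<notin> {\<psi>1, bar \<psi>1} \<and> m \<psi>1 * m (bar \<psi>1) * m \<psi>2 * m (bar \<psi>2) \<noteq> 0 \<longrightarrow>
            (\<psi>1 \<noteq> bar \<psi>1 \<and> \<psi>2 \<noteq> bar \<psi>2 \<longrightarrow>
               \<not> lie_group_isomorphic (SU (m \<psi>1) (m (bar \<psi>1))) (SU (m \<psi>2) (m (bar \<psi>2)))) \<and>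
            (\<psi>1 = bar \<psi>1 \<and> \<psi>2 = bar \<psi>2 \<longrightarrow>
               Sp_real (2 * m \<psi>1) \<noteq> Sp_real (2 * m \<psi>2)))"

end

theory Submission
  imports Defs "HOL-Complex_Analysis.Complex_Analysis"
begin

text \<open>Only a vanishing statement about eigenspaces is needed.  Write the characters of the group
  as \<open>g \<mapsto> exp (2 \<pi> i n g / d)\<close>.  In the families over the projective line, all pairs of conjugate
  nonreal characters with at most one exception contain an \<open>n\<close> with
  \<open>(\<Sum>\<theta>. n \<theta> mod d) < 2 d\<close>, and for such \<open>n\<close> the eigenspace of \<open>n\<close> is zero; in the families over
  curves of genus 1 we have \<open>d \<le> 4\<close>, so that there is at most one such pair anyway.

  For the vanishing let \<open>\<omega>\<close> be an eigendifferential of a covering \<open>\<pi>\<close> of the projective line with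
  coordinate \<open>z\<close>.  The \<open>d\<close>-th power of \<open>\<omega> / \<pi>\<^sup>* dz\<close> is invariant, hence descends to a function \<open>h\<close>
  that is holomorphic off the branch points.  Since \<open>\<omega>\<close> is holomorphic, \<open>h\<close> has order greater than
  \<open>- d\<close> at a branch point, and since the local monodromy \<open>\<theta>\<close> multiplies the \<open>d\<close>-th root of \<open>h\<close> by a
  known root of unity, this order is congruent to \<open>- n \<theta>\<close> modulo \<open>d\<close>; so it is at least
  \<open>- (n \<theta> mod d)\<close>.  As \<open>dz\<close> has a double pole at infinity, Liouville's theorem gives \<open>h = 0\<close> when
  \<open>(\<Sum>\<theta>. n \<theta> mod d) < 2 d\<close>.\<close>

subsection \<open>Charts\<close>

lemma
  assumes "compact_riemann_surface X" "c \<in> atlas X"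
  shows chart_openin: "openin (curve_top X) (fst c)"
    and open_chart_image: "open (snd c ` fst c)"
    and chart_homeomorphic:
      "homeomorphic_map (subtopology (curve_top X) (fst c)) (top_of_set (snd c ` fst c)) (snd c)"
  using assms by (auto simp: compact_riemann_surface_def complex_chart_def)

lemma chart_subset: "compact_riemann_surface X \<Longrightarrow> c \<in> atlas X \<Longrightarrow> fst c \<subseteq> points X"
  using chart_openin openin_subset by blast

lemma inj_on_chart:
  assumes "compact_riemann_surface X" "c \<in> atlas X"
  shows "inj_on (snd c) (fst c)"
  using homeomorphic_imp_injective_map[OF chart_homeomorphic[OF assms]] chart_subset[OF assms]
  by (simp add: inf_absorb2)

lemma obtain_chart:
  assumes "compact_riemann_surface X" "x \<in> points X"
  obtains c where "c \<in> atlas X" "x \<in> fst c"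
  using assms unfolding compact_riemann_surface_def by (metis UN_E)

lemma chart_inv_chart [simp]:
  "compact_riemann_surface X \<Longrightarrow> c \<in> atlas X \<Longrightarrow> x \<in> fst c \<Longrightarrow> chart_inv c (snd c x) = x"
  by (simp add: inj_on_chart)

lemma chart_inv_in: "z \<in> snd c ` fst c \<Longrightarrow> chart_inv c z \<in> fst c"
  by (rule inv_into_into)

lemma chart_chart_inv: "z \<in> snd c ` fst c \<Longrightarrow> snd c (chart_inv c z) = z"
  by (rule f_inv_into_f)

lemma open_chart_image_openin:
  assumes "compact_riemann_surface X" "c \<in> atlas X" "openin (curve_top X) U" "U \<subseteq> fst c"
  shows "open (snd c ` U)"
proof -
  have "open_map (subtopology (curve_top X) (fst c)) (top_of_set (snd c ` fst c)) (snd c)"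
    using chart_homeomorphic[OF assms(1,2)] homeomorphic_imp_open_map by blast
  moreover have "openin (subtopology (curve_top X) (fst c)) U"
    using assms by (metis inf.absorb1 openin_subtopology)
  ultimately have "openin (top_of_set (snd c ` fst c)) (snd c ` U)"
    by (auto simp: open_map_def)
  then show ?thesis
    using open_chart_image[OF assms(1,2)] by (simp add: openin_open_eq)
qed

lemma continuous_map_chart_inv:
  assumes "compact_riemann_surface X" "c \<in> atlas X"
  shows "continuous_map (top_of_set (snd c ` fst c)) (curve_top X) (chart_inv c)"
  unfolding continuous_map_def
proof (intro conjI allI impI)
  show "chart_inv c \<in> topspace (top_of_set (snd c ` fst c)) \<rightarrow> points X"
    using chart_subset[OF assms] chart_inv_in[of _ c] by auto
next
  fix U assume U: "openin (curve_top X) U"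
  have "{z \<in> topspace (top_of_set (snd c ` fst c)). chart_inv c z \<in> U} = snd c ` (fst c \<inter> U)"
    using assms by (auto simp: inv_into_f_f[OF inj_on_chart[OF assms]])
  moreover have "open (snd c ` (fst c \<inter> U))"
    using U assms by (intro open_chart_image_openin) (auto intro: chart_openin)
  ultimately show "openin (top_of_set (snd c ` fst c))
      {z \<in> topspace (top_of_set (snd c ` fst c)). chart_inv c z \<in> U}"
    by (metis (no_types, lifting) inf_le1 image_mono open_subset)
qed

section \<open>Holomorphic maps in coordinates\<close>

lemma holomorphic_map_id:
  "compact_riemann_surface X \<Longrightarrow> holomorphic_map X X (\<lambda>x. x)"
  by (auto simp: holomorphic_map_def compact_riemann_surface_def)

lemma openin_holomorphic_preimage:
  assumes "holomorphic_map X Y f" "compact_riemann_surface X" "c \<in> atlas X" "openin (curve_top Y) V"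
  shows "openin (curve_top X) (fst c \<inter> f -` V)"
proof -
  have "openin (curve_top X) {x \<in> points X. f x \<in> V}"
    using assms by (intro openin_continuous_map_preimage) (auto simp: holomorphic_map_def)
  then have "openin (curve_top X) (fst c \<inter> {x \<in> points X. f x \<in> V})"
    using chart_openin[OF assms(2,3)] by blast
  moreover have "fst c \<inter> {x \<in> points X. f x \<in> V} = fst c \<inter> f -` V"
    using chart_subset[OF assms(2,3)] by auto
  ultimately show ?thesis by simp
qed

lemma coord_expr_holomorphic:
  assumes "holomorphic_map X Y f" "compact_riemann_surface X" "compact_riemann_surface Y"
    "c \<in> atlas X" "c' \<in> atlas Y"
  shows "coord_expr c f c' holomorphic_on snd c ` (fst c \<inter> f -` fst c')"
    "open (snd c ` (fst c \<inter> f -` fst c'))"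
proof -
  show "coord_expr c f c' holomorphic_on snd c ` (fst c \<inter> f -` fst c')"
    using assms by (auto simp: holomorphic_map_def)
  show "open (snd c ` (fst c \<inter> f -` fst c'))"
    using assms by (intro open_chart_image_openin openin_holomorphic_preimage chart_openin) auto
qed

lemma coord_expr_chart:
  "compact_riemann_surface X \<Longrightarrow> c \<in> atlas X \<Longrightarrow> x \<in> fst c \<Longrightarrow>
    coord_expr c f c' (snd c x) = snd c' (f x)"
  by (simp add: coord_expr_def)

lemma coord_expr_differentiable:
  assumes "holomorphic_map X Y f" "compact_riemann_surface X" "compact_riemann_surface Y"
    "c \<in> atlas X" "c' \<in> atlas Y" "x \<in> fst c" "f x \<in> fst c'"
  shows "coord_expr c f c' field_differentiable at (snd c x)"
  using coord_expr_holomorphic[OF assms(1-5)] assms(6,7)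
  by (intro holomorphic_on_imp_differentiable_at) auto

text \<open>The chain rule in charts. The composite is a separate function \<open>h\<close> that has
  to agree with it on points only. So the rule applies to
  \<open>\<pi> (\<rho> g x) = \<pi> x\<close>, which is known on \<open>points C\<close> only, and
  to changes of chart, where \<open>f\<close> or \<open>g\<close> is the identity.\<close>

lemma deriv_coord_expr_comp:
  assumes "compact_riemann_surface X" "compact_riemann_surface Y" "compact_riemann_surface Z"
    and "holomorphic_map X Y f" "holomorphic_map Y Z g"
    and "c \<in> atlas X" "c' \<in> atlas Y" "c'' \<in> atlas Z"
    and "x \<in> fst c" "f x \<in> fst c'" "g (f x) \<in> fst c''"
    and h: "\<And>y. y \<in> points X \<Longrightarrow> h y = g (f y)"
  shows "deriv (coord_expr c h c'') (snd c x) =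
    deriv (coord_expr c' g c'') (snd c' (f x)) * deriv (coord_expr c f c') (snd c x)"
proof -
  let ?W = "snd c ` (fst c \<inter> f -` fst c')"
  have W: "open ?W" "snd c x \<in> ?W"
    using coord_expr_holomorphic(2)[OF assms(4,1,2,6,7)] assms by auto
  have "coord_expr c h c'' u = (coord_expr c' g c'' \<circ> coord_expr c f c') u" if "u \<in> ?W" for u
    using that assms chart_subset[OF assms(1,6)] by (auto simp: coord_expr_def h)
  then have "deriv (coord_expr c h c'') (snd c x) =
      deriv (coord_expr c' g c'' \<circ> coord_expr c f c') (snd c x)"
    using W by (intro deriv_cong_ev) (auto simp: eventually_nhds)
  also have "\<dots> = deriv (coord_expr c' g c'') (coord_expr c f c' (snd c x)) *
      deriv (coord_expr c f c') (snd c x)"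
    using assms by (intro deriv_chain coord_expr_differentiable) (auto simp: coord_expr_chart
       intro!: coord_expr_differentiable)
  finally show ?thesis using assms by (simp add: coord_expr_chart)
qed

subsection \<open>Cyclic coverings\<close>

locale cyclic_cover =
  fixes d :: nat and \<Theta> :: "int list" and C :: "'a curve" and \<rho> :: "int \<Rightarrow> 'a \<Rightarrow> 'a"
    and C' :: "'b curve" and \<pi> :: "'a \<Rightarrow> 'b" and ps :: "'b list"
  assumes cover: "cyclic_covering d \<Theta> C \<rho> C' \<pi> ps"
    and d_pos: "0 < d"
begin

abbreviation G :: "int set" where "G \<equiv> carrier (integer_mod_group d)"

lemma G_eq: "G = {0..<int d}"
  using d_pos by (simp add: carrier_integer_mod_group)

lemma finite_G: "finite G"
  by (simp add: G_eq)

lemma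
  shows rs_C: "compact_riemann_surface C" and rs_C': "compact_riemann_surface C'"
    and holomorphic_proj: "holomorphic_map C C' \<pi>" and proj_onto: "\<pi> ` points C = points C'"
    and action: "group_action (integer_mod_group d) (points C) \<rho>"
    and holomorphic_act: "g \<in> G \<Longrightarrow> holomorphic_map C C (\<rho> g)"
    and proj_eq_iff: "x \<in> points C \<Longrightarrow> y \<in> points C \<Longrightarrow> \<pi> x = \<pi> y \<longleftrightarrow> (\<exists>g\<in>G. y = \<rho> g x)"
    and distinct_branch: "distinct ps" and branch_subset: "set ps \<subseteq> points C'"
    and length_branch: "length ps = length \<Theta>" and monodromy_in: "set \<Theta> \<subseteq> G - {0}"
    and free_act: "x \<in> points C \<Longrightarrow> \<pi> x \<notin> set ps \<Longrightarrow> g \<in> G \<Longrightarrow> \<rho> g x = x \<Longrightarrow> g = 0"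
    and monodromy: "i < length \<Theta> \<Longrightarrow> local_monodromy C \<rho> C' \<pi> ps (ps ! i) (\<Theta> ! i)"
  using cover by (auto simp: cyclic_covering_def smooth_projective_curve_def)

lemma act_closed: "g \<in> G \<Longrightarrow> x \<in> points C \<Longrightarrow> \<rho> g x \<in> points C"
  using group_action.element_image[OF action] by blast

lemma act_zero: "x \<in> points C \<Longrightarrow> \<rho> 0 x = x"
  using group_action.id_eq_one[OF action] by (metis one_integer_mod_group restrict_apply')

lemma proj_act: "g \<in> G \<Longrightarrow> x \<in> points C \<Longrightarrow> \<pi> (\<rho> g x) = \<pi> x"
  using proj_eq_iff act_closed by metis

lemma finite_fibre: "finite {x \<in> points C. \<pi> x = p}"
proof (cases "\<exists>x\<in>points C. \<pi> x = p")
  case True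
  then obtain x where "x \<in> points C" "\<pi> x = p" by auto
  then have "y \<in> (\<lambda>g. \<rho> g x) ` G" if "y \<in> points C" "\<pi> y = p" for y
    using proj_eq_iff[of x y] that by auto
  then have "{x \<in> points C. \<pi> x = p} \<subseteq> (\<lambda>g. \<rho> g x) ` G" by auto
  then show ?thesis using finite_G finite_surj by blast
next
  case False
  then have "{x \<in> points C. \<pi> x = p} = {}" by blast
  then show ?thesis by (simp only: finite.emptyI)
qed

section \<open>The covering away from the branch points\<close>

lemma openin_off_branch:
  assumes "openin (curve_top C') V" "B \<subseteq> set ps" shows "openin (curve_top C') (V - B)"
proof -
  have "B \<subseteq> points C'" "finite B"
    using assms(2) branch_subset finite_subset by blast+
  then have "closedin (curve_top C') B"
    using rs_C' Hausdorff_imp_t1_space t1_space_closedin_finite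
    by (metis compact_riemann_surface_def)
  then show ?thesis using assms by (simp add: openin_diff)
qed

text \<open>The stabiliser of \<open>x\<close> is trivial, so the Hausdorff property separates
  \<open>x\<close> from each of its finitely many other translates. The intersection of the
  resulting neighbourhoods is moved off itself by every nonzero \<open>g\<close>; hence it meets
  each orbit, that is each fibre, at most once.\<close>

lemma inj_proj_nbhd:
  assumes x: "x \<in> points C" "\<pi> x \<notin> set ps" and U0: "openin (curve_top C) U0" "x \<in> U0"
  obtains U where "openin (curve_top C) U" "x \<in> U" "U \<subseteq> U0" "inj_on \<pi> U"
proof -
  have Hd: "Hausdorff_space (curve_top C)"
    using rs_C by (simp add: compact_riemann_surface_def)
  have "\<exists>A B. openin (curve_top C) A \<and> openin (curve_top C) B \<and> x \<in> A \<and> \<rho> g x \<in> B \<and> disjnt A B"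
    if "g \<in> G - {0}" for g
  proof -
    have "\<rho> g x \<noteq> x" "\<rho> g x \<in> points C"
      using that free_act x act_closed by auto
    then show ?thesis using Hd x by (simp add: Hausdorff_space_def)
  qed
  then obtain A B where AB: "\<And>g. g \<in> G - {0} \<Longrightarrow> openin (curve_top C) (A g) \<and>
      openin (curve_top C) (B g) \<and> x \<in> A g \<and> \<rho> g x \<in> B g \<and> disjnt (A g) (B g)"
    by metis
  define W where "W g = A g \<inter> {y \<in> points C. \<rho> g y \<in> B g}" for g
  have W: "openin (curve_top C) (W g) \<and> x \<in> W g" if "g \<in> G - {0}" for g
  proof -
    have "openin (curve_top C) {y \<in> points C. \<rho> g y \<in> B g}"
      using AB[OF that] that holomorphic_act[of g]
      by (intro openin_continuous_map_preimage) (auto simp: holomorphic_map_def)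
    then show ?thesis using AB[OF that] x by (auto simp: W_def)
  qed
  \<comment> \<open>Inserting \<open>points C\<close> keeps the family nonempty when the group is
    trivial and puts all elements of \<open>?U\<close> into the curve.\<close>
  let ?U = "U0 \<inter> \<Inter> (insert (points C) (W ` (G - {0})))"
  show ?thesis
  proof
    show "openin (curve_top C) ?U"
      using W finite_G U0(1) by (intro openin_Int openin_Inter) auto
    show "x \<in> ?U" using W U0 x by auto
    show "inj_on \<pi> ?U"
    proof (rule inj_onI)
      fix y z assume y: "y \<in> ?U" and z: "z \<in> ?U" and "\<pi> y = \<pi> z"
      then obtain g where g: "g \<in> G" "z = \<rho> g y" using proj_eq_iff by auto
      show "y = z"
      proof (cases "g = 0")
        case False
        then have "z \<in> A g" "\<rho> g y \<in> B g" using y z g by (auto simp: W_def)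
        then show ?thesis using AB[of g] g False by (auto simp: disjnt_def)
      qed (use g y act_zero in auto)
    qed
  qed auto
qed

text \<open>In coordinates the projection is injective near \<open>x\<close>, and an injective
  holomorphic function on an open set has an open image, no critical points and a holomorphic
  inverse. This inverse is \<open>s\<close>, a section of the covering written in the charts
  \<open>c'\<close> and \<open>c\<close>.\<close>

lemma local_section:
  assumes c: "c \<in> atlas C" "x \<in> fst c" and c': "c' \<in> atlas C'" "\<pi> x \<in> fst c'" "\<pi> x \<notin> set ps"
  obtains V s where "open V" "snd c' (\<pi> x) \<in> V" "V \<subseteq> snd c' ` (fst c' - set ps)"
    "s holomorphic_on V" "s (snd c' (\<pi> x)) = snd c x" "s ` V \<subseteq> snd c ` fst c"
    "\<And>z. z \<in> V \<Longrightarrow> \<pi> (chart_inv c (s z)) = chart_inv c' z"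
    "\<And>z. z \<in> V \<Longrightarrow> deriv (coord_expr c \<pi> c') (s z) \<noteq> 0"
    "coord_expr c \<pi> c' holomorphic_on s ` V" "open (s ` V)"
proof -
  have x: "x \<in> points C" using c chart_subset[OF rs_C] by blast
  let ?U0 = "fst c \<inter> \<pi> -` (fst c' - set ps)"
  have "openin (curve_top C) ?U0"
    using openin_holomorphic_preimage[OF holomorphic_proj rs_C c(1)] openin_off_branch[OF _ subset_refl]
      chart_openin[OF rs_C' c'(1)] by blast
  then obtain U where U: "openin (curve_top C) U" "x \<in> U" "U \<subseteq> ?U0" "inj_on \<pi> U"
    using inj_proj_nbhd[OF x c'(3)] c c' by blast
  let ?S = "snd c ` U" and ?P = "coord_expr c \<pi> c'"
  have S: "open ?S" using U by (intro open_chart_image_openin[OF rs_C c(1)]) auto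
  have P: "?P (snd c u) = snd c' (\<pi> u)" if "u \<in> U" for u
    using that U coord_expr_chart[OF rs_C c(1), of u \<pi> c'] by auto
  have hol: "?P holomorphic_on ?S"
    using coord_expr_holomorphic(1)[OF holomorphic_proj rs_C rs_C' c(1) c'(1)]
    by (rule holomorphic_on_subset) (use U(3) in auto)
  have inj: "inj_on ?P ?S"
  proof (rule inj_onI, elim imageE)
    fix a b u v assume "?P a = ?P b" "a = snd c u" "b = snd c v" "u \<in> U" "v \<in> U"
    then have "snd c' (\<pi> u) = snd c' (\<pi> v)" using P by simp
    then have "\<pi> u = \<pi> v"
      using inj_on_chart[OF rs_C' c'(1)] U(3) \<open>u \<in> U\<close> \<open>v \<in> U\<close> by (auto dest!: inj_onD)
    then show "a = b" using U(4) \<open>a = _\<close> \<open>b = _\<close> \<open>u \<in> U\<close> \<open>v \<in> U\<close> by (auto dest: inj_onD)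
  qed
  obtain s where s: "s holomorphic_on ?P ` ?S" "\<And>z. z \<in> ?S \<Longrightarrow> s (?P z) = z"
    using holomorphic_has_inverse[OF hol S inj] by metis
  show ?thesis
  proof
    show "open (?P ` ?S)" using open_mapping_thm3[OF hol S inj] .
    show "snd c' (\<pi> x) \<in> ?P ` ?S" using P[OF U(2)] U(2) by (metis image_eqI)
    show "?P ` ?S \<subseteq> snd c' ` (fst c' - set ps)" using P U(3) by auto
    show "s holomorphic_on ?P ` ?S" by fact
    show "s (snd c' (\<pi> x)) = snd c x" using s(2)[of "snd c x"] P[OF U(2)] U(2) by auto
    have sS: "s ` ?P ` ?S = ?S" using s(2) by (force simp: image_iff)
    show "s ` ?P ` ?S \<subseteq> snd c ` fst c" using U(3) unfolding sS by auto
    show "?P holomorphic_on s ` ?P ` ?S" "open (s ` ?P ` ?S)"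
      unfolding sS by fact+
    fix z assume "z \<in> ?P ` ?S"
    then obtain u where u: "u \<in> U" "z = ?P (snd c u)" by auto
    then have "s z = snd c u" "z = snd c' (\<pi> u)" using s(2)[of "snd c u"] P[of u] by auto
    moreover have "u \<in> fst c" "\<pi> u \<in> fst c'" using u U(3) by auto
    ultimately show "\<pi> (chart_inv c (s z)) = chart_inv c' z"
      using chart_inv_chart[OF rs_C c(1)] chart_inv_chart[OF rs_C' c'(1)] by simp
    show "deriv ?P (s z) \<noteq> 0"
      using holomorphic_injective_imp_regular[OF hol S inj] u \<open>s z = snd c u\<close> by auto
  qed
qed

lemma deriv_proj_nonzero:
  assumes "c \<in> atlas C" "x \<in> fst c" "c' \<in> atlas C'" "\<pi> x \<in> fst c'" "\<pi> x \<notin> set ps"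
  shows "deriv (coord_expr c \<pi> c') (snd c x) \<noteq> 0"
  using local_section[OF assms] by metis

end

subsection \<open>Eigendifferentials\<close>

text \<open>\<open>- g mod int d\<close> is the inverse of \<open>g\<close>, so \<open>eigen\<close>
  expresses membership in the eigenspace of \<open>multiplicity_H0\<close>. The index
  \<open>n\<close> is any natural number, not a residue in a fixed range.\<close>

locale eigendifferential = cyclic_cover d \<Theta> C \<rho> C' \<pi> ps
  for d :: nat and \<Theta> :: "int list" and C :: "'a curve" and \<rho> :: "int \<Rightarrow> 'a \<Rightarrow> 'a"
    and C' :: "'b curve" and \<pi> :: "'a \<Rightarrow> 'b" and ps :: "'b list" +
  fixes n :: nat and \<psi> :: "int \<Rightarrow> complex" and \<omega> :: "'a differential"
  assumes differential: "\<omega> \<in> holomorphic_differentials C"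
    and eigen: "\<And>g. g \<in> G \<Longrightarrow>
      pullback_differential C (\<rho> (- g mod int d)) \<omega> = scale_differential (\<psi> g) \<omega>"
    and character: "\<And>g. g \<in> G \<Longrightarrow> \<psi> g = cis (2 * pi * (real n * real_of_int g / real d))"
begin

lemma character_pow: "g \<in> G \<Longrightarrow> \<psi> g ^ d = 1"
proof -
  assume g: "g \<in> G"
  then have "\<psi> g ^ d = cis (real d * (2 * pi * (real n * real_of_int g / real d)))"
    by (simp only: character[OF g] Complex.DeMoivre)
  also have "real d * (2 * pi * (real n * real_of_int g / real d)) =
      2 * pi * (real n * real_of_int g)"
    using d_pos by simp
  also have "cis \<dots> = 1" by (rule cis_multiple_2pi) auto
  finally show ?thesis .
qed

lemma coefficient_holomorphic:
  "c \<in> atlas C \<Longrightarrow> (\<lambda>z. \<omega> c (chart_inv c z)) holomorphic_on snd c ` fst c"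
  using differential by (auto simp: holomorphic_differentials_def)

text \<open>\<open>quot c' x\<close> is the value at \<open>x\<close> of the quotient of \<open>\<omega>\<close> by the pullback of the differential of
  the coordinate of \<open>c'\<close>; it is meaningful off the fibres of the branch points.\<close>

definition quot :: "'b chart \<Rightarrow> 'a \<Rightarrow> complex" where
  "quot c' x = (let c = (SOME c. c \<in> atlas C \<and> x \<in> fst c)
                in \<omega> c x / deriv (coord_expr c \<pi> c') (snd c x))"

text \<open>A change of chart on \<open>C\<close> multiplies the coefficient of
  \<open>\<omega>\<close> and the derivative of the projection by the same factor. It is nonzero
  because the covering is unramified off the branch points, so it cancels and any chart around
  \<open>x\<close> may be used.\<close>

lemma quot_eq:
  assumes c: "c \<in> atlas C" "x \<in> fst c" and c': "c' \<in> atlas C'" "\<pi> x \<in> fst c'" "\<pi> x \<notin> set ps"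
  shows "quot c' x = \<omega> c x / deriv (coord_expr c \<pi> c') (snd c x)"
proof -
  define k where "k = (SOME c. c \<in> atlas C \<and> x \<in> fst c)"
  have k: "k \<in> atlas C" "x \<in> fst k"
    using someI[of "\<lambda>c. c \<in> atlas C \<and> x \<in> fst c" c] c by (auto simp: k_def)
  let ?T = "deriv (coord_expr c (\<lambda>x. x) k) (snd c x)"
  have "\<omega> c x = \<omega> k x * ?T"
    using differential c k unfolding holomorphic_differentials_def by blast
  moreover have "deriv (coord_expr c \<pi> c') (snd c x) = deriv (coord_expr k \<pi> c') (snd k x) * ?T"
    using c k c' by (intro deriv_coord_expr_comp[OF rs_C rs_C rs_C' holomorphic_map_id holomorphic_proj])
      (auto intro: rs_C)
  ultimately show ?thesis
    using deriv_proj_nonzero[OF c c'] by (simp add: quot_def Let_def flip: k_def)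
qed

text \<open>Since \<open>\<pi>\<close> is unchanged by the action, so is the pullback of the
  differential of the coordinate; the quotient therefore inherits the eigenvalue of
  \<open>\<omega>\<close>.\<close>

lemma quot_act_uminus:
  assumes g: "g \<in> G" and x: "x \<in> points C" and c': "c' \<in> atlas C'" "\<pi> x \<in> fst c'" "\<pi> x \<notin> set ps"
  shows "quot c' (\<rho> (- g mod int d) x) = \<psi> g * quot c' x"
proof -
  obtain c where c: "c \<in> atlas C" "x \<in> fst c" using obtain_chart[OF rs_C x] .
  let ?h = "\<rho> (- g mod int d)"
  have g': "- g mod int d \<in> G" using d_pos by (simp add: G_eq)
  have hx: "?h x \<in> points C" "\<pi> (?h x) = \<pi> x" using act_closed proj_act g' x by auto
  \<comment> \<open>This is the chart that \<open>pullback_differential\<close> itself selects at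
    the translated point, so that \<open>eigen\<close> can be evaluated at \<open>x\<close>.\<close>
  define k where "k = (SOME c. c \<in> atlas C \<and> ?h x \<in> fst c)"
  have k: "k \<in> atlas C" "?h x \<in> fst k"
    using someI_ex[of "\<lambda>c. c \<in> atlas C \<and> ?h x \<in> fst c"] obtain_chart[OF rs_C hx(1)]
    unfolding k_def by metis+
  let ?T = "deriv (coord_expr c ?h k) (snd c x)"
  have "pullback_differential C ?h \<omega> c x = scale_differential (\<psi> g) \<omega> c x"
    using eigen[OF g] by simp
  then have 1: "\<omega> k (?h x) * ?T = \<psi> g * \<omega> c x"
    using c by (simp add: pullback_differential_def scale_differential_def Let_def flip: k_def)
  have 2: "deriv (coord_expr c \<pi> c') (snd c x) = deriv (coord_expr k \<pi> c') (snd k (?h x)) * ?T"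
    using c k c' hx proj_act g'
    by (intro deriv_coord_expr_comp[OF rs_C rs_C rs_C' holomorphic_act[OF g'] holomorphic_proj]) auto
  have 3: "deriv (coord_expr c \<pi> c') (snd c x) \<noteq> 0"
    using deriv_proj_nonzero[OF c c'] .
  have "quot c' (?h x) = (\<omega> k (?h x) * ?T) / (deriv (coord_expr k \<pi> c') (snd k (?h x)) * ?T)"
    using quot_eq[OF k c'(1)] c' hx 2 3 by simp
  moreover have "quot c' x = \<omega> c x / deriv (coord_expr c \<pi> c') (snd c x)"
    using quot_eq[OF c c'] .
  ultimately show ?thesis using 1 2 by simp
qed

lemma quot_act:
  assumes "g \<in> G" "x \<in> points C" "c' \<in> atlas C'" "\<pi> x \<in> fst c'" "\<pi> x \<notin> set ps"
  shows "quot c' (\<rho> g x) = \<psi> (- g mod int d) * quot c' x"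
proof -
  have "- (- g mod int d) mod int d = g" using assms(1) d_pos by (simp add: G_eq mod_minus_eq)
  moreover have "- g mod int d \<in> G" using d_pos by (simp add: G_eq)
  ultimately show ?thesis using quot_act_uminus[OF _ assms(2-5), of "- g mod int d"] by simp
qed

section \<open>The descended function \<open>h\<close> on the quotient curve\<close>

definition descent :: "'b chart \<Rightarrow> complex \<Rightarrow> complex" where
  "descent c' z = quot c' (SOME x. x \<in> points C \<and> \<pi> x = chart_inv c' z) ^ d"

text \<open>Two points of a fibre differ by a group element, which changes \<open>quot\<close> by a
  value of the character. That value is a \<open>d\<close>-th root of unity, so the power does not
  depend on the point chosen in \<open>descent\<close>.\<close>

lemma descent_eq:
  assumes x: "x \<in> points C" and c': "c' \<in> atlas C'" "\<pi> x \<in> fst c'" "\<pi> x \<notin> set ps"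
  shows "descent c' (snd c' (\<pi> x)) = quot c' x ^ d"
proof -
  define y where "y = (SOME y. y \<in> points C \<and> \<pi> y = \<pi> x)"
  have "y \<in> points C \<and> \<pi> y = \<pi> x"
    unfolding y_def by (rule someI[of _ x]) (use x in auto)
  then obtain g where g: "g \<in> G" "y = \<rho> g x" using proj_eq_iff[OF x, of y] by auto
  have g': "- g mod int d \<in> G" using d_pos by (simp add: G_eq)
  have "descent c' (snd c' (\<pi> x)) = quot c' y ^ d"
    by (simp only: descent_def chart_inv_chart[OF rs_C' c'(1,2)] y_def)
  also have "\<dots> = quot c' x ^ d"
    by (simp only: g(2) quot_act[OF g(1) x c'] power_mult_distrib character_pow[OF g'] mult_1)
  finally show ?thesis .
qed

text \<open>The hypotheses on \<open>s\<close> are what \<open>local_section\<close> supplies. Along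
  the section \<open>quot\<close> is a quotient of holomorphic functions with nonvanishing
  denominator; this yields both the holomorphy of \<open>descent\<close> and the continuity of
  \<open>quot\<close> along lifted paths.\<close>

lemma quot_section_holomorphic:
  assumes c: "c \<in> atlas C" and c': "c' \<in> atlas C'" 
    and V: "open V" "V \<subseteq> snd c' ` (fst c' - set ps)" "s holomorphic_on V" "s ` V \<subseteq> snd c ` fst c"
    "\<And>z. z \<in> V \<Longrightarrow> \<pi> (chart_inv c (s z)) = chart_inv c' z"
    "\<And>z. z \<in> V \<Longrightarrow> deriv (coord_expr c \<pi> c') (s z) \<noteq> 0"
    "coord_expr c \<pi> c' holomorphic_on s ` V" "open (s ` V)"
  shows "(\<lambda>z. quot c' (chart_inv c (s z))) holomorphic_on V"
    and "z \<in> V \<Longrightarrow> descent c' z = quot c' (chart_inv c (s z)) ^ d"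
proof -
  have x: "chart_inv c (s z) \<in> fst c" "snd c (chart_inv c (s z)) = s z"
       "\<pi> (chart_inv c (s z)) \<in> fst c' - set ps" "snd c' (\<pi> (chart_inv c (s z))) = z"
    if zV: "z \<in> V" for z
  proof -
    have sz: "s z \<in> snd c ` fst c" using V(4) zV by auto
    show "chart_inv c (s z) \<in> fst c" "snd c (chart_inv c (s z)) = s z"
      using chart_inv_in[OF sz] chart_chart_inv[OF sz] by auto
    obtain p where "p \<in> fst c' - set ps" "z = snd c' p" using V(2) zV by blast
    then show "\<pi> (chart_inv c (s z)) \<in> fst c' - set ps" "snd c' (\<pi> (chart_inv c (s z))) = z"
      using V(5)[OF zV] chart_inv_chart[OF rs_C' c'] by auto
  qed
  have "(\<lambda>u. \<omega> c (chart_inv c u)) \<circ> s holomorphic_on V"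
    using coefficient_holomorphic[OF c] V(3,4) holomorphic_on_compose_gen by blast
  moreover have "deriv (coord_expr c \<pi> c') \<circ> s holomorphic_on V"
    using holomorphic_deriv[OF V(7,8)] V(3) holomorphic_on_compose by blast
  ultimately have "(\<lambda>z. \<omega> c (chart_inv c (s z)) / deriv (coord_expr c \<pi> c') (s z)) holomorphic_on V"
    using V(6) by (intro holomorphic_on_divide) (auto simp: o_def)
  moreover have "quot c' (chart_inv c (s z)) =
      \<omega> c (chart_inv c (s z)) / deriv (coord_expr c \<pi> c') (s z)" if "z \<in> V" for z
    using quot_eq[OF c x(1)[OF that] c'] x[OF that] by auto
  ultimately show "(\<lambda>z. quot c' (chart_inv c (s z))) holomorphic_on V"
    by (simp cong: holomorphic_cong)
  show "descent c' z = quot c' (chart_inv c (s z)) ^ d" if "z \<in> V"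
    using descent_eq[OF _ c', of "chart_inv c (s z)"] x[OF that] chart_subset[OF rs_C c] by auto
qed

lemma descent_holomorphic:
  assumes c': "c' \<in> atlas C'"
  shows "descent c' holomorphic_on snd c' ` (fst c' - set ps)"
  unfolding holomorphic_on_def
proof safe
  fix p assume p: "p \<in> fst c'" "p \<notin> set ps"
  obtain x where x: "x \<in> points C" "\<pi> x = p"
    using proj_onto chart_subset[OF rs_C' c'] p by (metis imageE subsetD)
  obtain c where c: "c \<in> atlas C" "x \<in> fst c" using obtain_chart[OF rs_C x(1)] .
  have p': "\<pi> x \<in> fst c'" "\<pi> x \<notin> set ps" using p x by auto
  obtain V s where V: "open V" "snd c' (\<pi> x) \<in> V" "V \<subseteq> snd c' ` (fst c' - set ps)"
    "s holomorphic_on V" "s ` V \<subseteq> snd c ` fst c"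
    "\<And>z. z \<in> V \<Longrightarrow> \<pi> (chart_inv c (s z)) = chart_inv c' z"
    "\<And>z. z \<in> V \<Longrightarrow> deriv (coord_expr c \<pi> c') (s z) \<noteq> 0"
    "coord_expr c \<pi> c' holomorphic_on s ` V" "open (s ` V)"
    using local_section[OF c c' p'] by metis
  note q = quot_section_holomorphic[OF c(1) c' V(1,3-)]
  have "(\<lambda>z. quot c' (chart_inv c (s z)) ^ d) holomorphic_on V"
    using q(1) by (intro holomorphic_intros)
  then have "descent c' holomorphic_on V"
    by (rule holomorphic_transform) (use q(2) in auto)
  then have "descent c' field_differentiable at (snd c' p)"
    using V(1,2) x(2) holomorphic_on_imp_differentiable_at by auto
  then show "descent c' field_differentiable at (snd c' p) within snd c' ` (fst c' - set ps)"
    using field_differentiable_at_within by blast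
qed

text \<open>At a point over \<open>p\<close> the function \<open>?P u - ?w\<close> vanishes to some
  order \<open>k\<close> and its derivative to order \<open>k - 1\<close>, so their quotient times
  the holomorphic coefficient of \<open>\<omega>\<close> tends to 0. The \<open>d\<close>-th power
  of this is the function in question. The point \<open>p\<close> may be a branch point or
  not.\<close>

lemma descent_growth:
  assumes c': "c' \<in> atlas C'" "p \<in> fst c'"
  shows "((\<lambda>w. (w - snd c' p) ^ d * descent c' w) \<longlongrightarrow> 0) (at (snd c' p))"
proof -
  obtain q where q: "q \<in> points C" "\<pi> q = p"
    using proj_onto chart_subset[OF rs_C' c'(1)] c'(2) by (metis imageE subsetD)
  obtain c where c: "c \<in> atlas C" "q \<in> fst c" using obtain_chart[OF rs_C q(1)] .
  let ?P = "coord_expr c \<pi> c'" and ?u = "snd c q" and ?w = "snd c' p"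
  \<comment> \<open>Only the branch points other than \<open>p\<close> are removed, so that
    \<open>p\<close> itself may be one of them.\<close>
  let ?S = "snd c ` (fst c \<inter> \<pi> -` (fst c' - set (removeAll p ps)))"
  have "openin (curve_top C') (fst c' - set (removeAll p ps))"
    using chart_openin[OF rs_C' c'(1)] by (rule openin_off_branch) auto
  then have "open ?S"
    using openin_holomorphic_preimage[OF holomorphic_proj rs_C c(1)]
    by (intro open_chart_image_openin[OF rs_C c(1)]) auto
  moreover have "?u \<in> ?S" using c q c' by auto
  ultimately obtain r where r: "0 < r" "ball ?u r \<subseteq> ?S" using openE by blast
  have S: "chart_inv c u \<in> fst c" "snd c (chart_inv c u) = u" "\<pi> (chart_inv c u) \<in> fst c'"
     "\<pi> (chart_inv c u) \<in> set ps \<Longrightarrow> \<pi> (chart_inv c u) = p" "?P u = snd c' (\<pi> (chart_inv c u))"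
     if u: "u \<in> ball ?u r" for u
  proof -
    obtain x where "u = snd c x" "x \<in> fst c" "\<pi> x \<in> fst c' - set (removeAll p ps)"
      using r(2) u by blast
    then show "chart_inv c u \<in> fst c" "snd c (chart_inv c u) = u" "\<pi> (chart_inv c u) \<in> fst c'"
     "\<pi> (chart_inv c u) \<in> set ps \<Longrightarrow> \<pi> (chart_inv c u) = p" "?P u = snd c' (\<pi> (chart_inv c u))"
      using chart_inv_chart[OF rs_C c(1)] coord_expr_chart[OF rs_C c(1), of _ \<pi> c'] by auto
  qed
  have Pu: "?P ?u = ?w" using coord_expr_chart[OF rs_C c, of \<pi> c'] q by simp
  have P_eq: "\<pi> (chart_inv c u) = p" if "u \<in> ball ?u r" "?P u = ?w" for u
    using S(3,5)[OF that(1)] that(2) inj_on_chart[OF rs_C' c'(1)] c'(2) by (metis inj_onD)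
  have hol: "?P holomorphic_on ball ?u r"
    using coord_expr_holomorphic(1)[OF holomorphic_proj rs_C rs_C' c(1) c'(1)]
    by (rule holomorphic_on_subset) (use r(2) in auto)
  \<comment> \<open>Otherwise a whole disc would lie in one fibre, but fibres are finite.\<close>
  have nonconst: "\<not> (\<lambda>u. ?P u - ?w) constant_on ball ?u r"
  proof
    assume "(\<lambda>u. ?P u - ?w) constant_on ball ?u r"
    then obtain k where k: "\<And>u. u \<in> ball ?u r \<Longrightarrow> ?P u - ?w = k" unfolding constant_on_def by blast
    then have "k = 0" using Pu r(1) by (metis centre_in_ball cancel_comm_monoid_add_class.diff_cancel)
    then have "?P u = ?w" if "u \<in> ball ?u r" for u using k[OF that] by simp
    then have "chart_inv c ` ball ?u r \<subseteq> {x \<in> points C. \<pi> x = p}"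
      using P_eq S(1) chart_subset[OF rs_C c(1)] by blast
    then have "finite (snd c ` chart_inv c ` ball ?u r)"
      using finite_fibre finite_subset by blast
    moreover have "snd c ` chart_inv c ` ball ?u r = ball ?u r"
      using S(2) by (auto simp: image_iff)
    ultimately show False using r(1) uncountable_ball countable_finite by metis
  qed
  have hol': "(\<lambda>u. ?P u - ?w) holomorphic_on ball ?u r"
    using hol by (intro holomorphic_intros)
  obtain g r' k where k: "0 < (k::nat)" "0 < r'" "ball ?u r' \<subseteq> ball ?u r" "g holomorphic_on ball ?u r'"
    "\<And>u. u \<in> ball ?u r' \<Longrightarrow> ?P u - ?w = (u - ?u) ^ k * g u"
    "\<And>u. u \<in> ball ?u r' \<Longrightarrow> g u \<noteq> 0"
  proof (rule holomorphic_factor_zero_nonconstant[OF hol' open_ball connected_ball, of ?u])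
    show "?u \<in> ball ?u r" "?P ?u - ?w = 0" using r(1) Pu by auto
  qed (use nonconst that in auto)
  let ?A = "\<lambda>u. (?P u - ?w) * \<omega> c (chart_inv c u) / deriv ?P u"
  have dP: "deriv ?P u = (u - ?u) ^ (k - 1) * (of_nat k * g u + (u - ?u) * deriv g u)"
    if u: "u \<in> ball ?u r'" for u
  proof -
    have g: "(g has_field_derivative deriv g u) (at u)"
      using k(4) u holomorphic_derivI by blast
    have "((\<lambda>u. (u - ?u) ^ k * g u + ?w) has_field_derivative
        (of_nat k * (u - ?u) ^ (k - 1) * g u + (u - ?u) ^ k * deriv g u)) (at u)"
      using k(1) by (auto intro!: derivative_eq_intros g)
    then have "(?P has_field_derivative
        (of_nat k * (u - ?u) ^ (k - 1) * g u + (u - ?u) ^ k * deriv g u)) (at u)"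
      by (rule has_field_derivative_transform_within_open[OF _ open_ball u])
        (use k(5) in \<open>simp flip: k(5)\<close>)
    then have "deriv ?P u = of_nat k * (u - ?u) ^ (k - 1) * g u + (u - ?u) ^ k * deriv g u"
      by (rule DERIV_imp_deriv)
    also have "\<dots> = (u - ?u) ^ (k - 1) * (of_nat k * g u + (u - ?u) * deriv g u)"
      using k(1) by (cases k) (auto simp: algebra_simps)
    finally show ?thesis .
  qed
  have A0: "(?A \<longlongrightarrow> 0) (at ?u)"
  proof -
    \<comment> \<open>This is \<open>?A\<close> with the common power
      \<open>(u - ?u) ^ (k - 1)\<close> cancelled. The remaining denominator equals
      \<open>of_nat k * g ?u\<close> at \<open>?u\<close>, hence is nonzero, and \<open>?B\<close>
      is continuous there with value 0.\<close>
    let ?B = "\<lambda>u. (u - ?u) * g u * \<omega> c (chart_inv c u) / (of_nat k * g u + (u - ?u) * deriv g u)"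
    have "isCont (\<lambda>u. \<omega> c (chart_inv c u)) ?u"
      using coefficient_holomorphic[OF c(1)] open_chart_image[OF rs_C c(1)] c(2)
      by (meson continuous_on_eq_continuous_at holomorphic_on_imp_continuous_on imageI)
    moreover have "isCont g ?u" "isCont (deriv g) ?u"
      using k(2,4) holomorphic_deriv[OF k(4) open_ball]
      by (meson centre_in_ball continuous_on_eq_continuous_at holomorphic_on_imp_continuous_on open_ball)+
    moreover have "of_nat k * g ?u \<noteq> 0" using k(1,2) k(6)[of ?u] by simp
    ultimately have "isCont ?B ?u" by (intro continuous_intros) auto
    then have "(?B \<longlongrightarrow> 0) (at ?u)" unfolding isCont_def by simp
    moreover have "eventually (\<lambda>u. ?A u = ?B u) (at ?u)"
    proof -
      have "?A u = ?B u" if "u \<in> ball ?u r'" "u \<noteq> ?u" for u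
      proof -
        have "(u - ?u) ^ k = (u - ?u) ^ (k - 1) * (u - ?u)" using k(1) by (cases k) auto
        moreover have "(u - ?u) ^ (k - 1) \<noteq> 0" using that by simp
        ultimately show ?thesis using dP[OF that(1)] k(5)[OF that(1)] by simp
      qed
      then show ?thesis using k(2) unfolding eventually_at_topological
        by (metis centre_in_ball open_ball)
    qed
    ultimately show ?thesis by (simp add: tendsto_cong)
  qed
  show ?thesis
  proof (rule tendstoI)
    fix e0 :: real assume "0 < e0"
    \<comment> \<open>The bound by 1 gives \<open>e ^ d \<le> e\<close>, needed once the estimate
      for \<open>?A\<close> is raised to the power \<open>d\<close>.\<close>
    define e where "e = min e0 1"
    have e: "0 < e" "e \<le> 1" "e \<le> e0" using \<open>0 < e0\<close> by (auto simp: e_def)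
    obtain \<delta>0 where \<delta>0: "\<delta>0 > 0" "\<And>u. u \<noteq> ?u \<Longrightarrow> dist u ?u < \<delta>0 \<Longrightarrow> norm (?A u) < e"
      using tendstoD[OF A0 e(1)] unfolding eventually_at by auto
    define \<delta> where "\<delta> = min \<delta>0 r'"
    have \<delta>: "0 < \<delta>" "ball ?u \<delta> \<subseteq> ball ?u r'" using \<delta>0 k(2) by (auto simp: \<delta>_def)
    have "\<not> ?P constant_on ball ?u r"
    proof
      assume "?P constant_on ball ?u r"
      then obtain k where "\<And>u. u \<in> ball ?u r \<Longrightarrow> ?P u = k" unfolding constant_on_def by blast
      then have "(\<lambda>u. ?P u - ?w) constant_on ball ?u r" unfolding constant_on_def by auto
      then show False using nonconst by blast
    qed
    \<comment> \<open>By the open mapping theorem every \<open>w\<close> near \<open>?w\<close> is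
      the image of a \<open>u\<close> near \<open>?u\<close>, so the limit in \<open>u\<close> gives
      the limit in \<open>w\<close>.\<close>
    then have "open (?P ` ball ?u \<delta>)"
      using open_mapping_thm[OF hol open_ball connected_ball open_ball] \<delta> k(3) by blast
    moreover have "?w \<in> ?P ` ball ?u \<delta>" using Pu \<delta>(1) by (metis centre_in_ball image_eqI)
    moreover have "dist ((w - ?w) ^ d * descent c' w) 0 < e0" if w: "w \<in> ?P ` ball ?u \<delta>" "w \<noteq> ?w" for w
    proof -
      obtain u where u: "u \<in> ball ?u \<delta>" "w = ?P u" using w by auto
      have u': "u \<in> ball ?u r'" "u \<in> ball ?u r" "u \<noteq> ?u"
        using subsetD[OF \<delta>(2) u(1)] subsetD[OF k(3)] u(2) w(2) Pu by auto
      let ?x = "chart_inv c u"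
      note x = S[OF u'(2)]
      have x': "?x \<in> points C" using x(1) chart_subset[OF rs_C c(1)] by blast
      have "\<pi> ?x \<noteq> p" using x(5) u w by auto
      then have "\<pi> ?x \<notin> set ps" using x(4) by auto
      then have "descent c' w = (\<omega> c ?x / deriv ?P u) ^ d"
        using descent_eq[OF x' c'(1) x(3)] quot_eq[OF c(1) x(1) c'(1) x(3)] x(2,5) u(2) by simp
      then have "(w - ?w) ^ d * descent c' w = ?A u ^ d"
        by (simp add: u(2) power_mult_distrib power_divide)
      moreover have "norm (?A u) < e"
        using \<delta>0(2) u u'(3) by (auto simp: \<delta>_def dist_commute)
      ultimately have "norm ((w - ?w) ^ d * descent c' w) < e ^ d"
        using d_pos by (simp add: norm_power power_strict_mono)
      also have "\<dots> \<le> e ^ 1" using e d_pos by (intro power_decreasing) auto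
      finally show ?thesis using e by simp
    qed
    ultimately show "eventually (\<lambda>w. dist ((w - ?w) ^ d * descent c' w) 0 < e0) (at ?w)"
      unfolding eventually_at_topological by blast
  qed
qed

text \<open>Short pieces lift by a local section followed by the group element that adjusts the
  starting point; bisection of the interval joins them. Continuity of \<open>quot\<close> along the
  lift is carried through the same induction.\<close>

lemma path_lift:
  fixes z :: "real \<Rightarrow> complex"
  assumes c': "c' \<in> atlas C'" and z: "continuous_on UNIV z" "range z \<subseteq> snd c' ` (fst c' - set ps)"
    and ab: "a \<le> b" and x: "x \<in> points C" "\<pi> x = chart_inv c' (z a)"
  obtains \<gamma> where "continuous_map (top_of_set {a..b}) (curve_top C) \<gamma>" "\<gamma> a = x"
    "\<And>t. t \<in> {a..b} \<Longrightarrow> \<pi> (\<gamma> t) = chart_inv c' (z t)"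
    "continuous_on {a..b} (\<lambda>t. quot c' (\<gamma> t))"
proof -
  define L where "L a b \<gamma> \<longleftrightarrow> continuous_map (top_of_set {a..b}) (curve_top C) \<gamma> \<and>
    (\<forall>t\<in>{a..b}. \<pi> (\<gamma> t) = chart_inv c' (z t)) \<and> continuous_on {a..b} (\<lambda>t. quot c' (\<gamma> t))"
    for a b \<gamma>
  \<comment> \<open>All starting points are treated at once, so that the second lift can start where
    the first one ends.\<close>
  have "\<forall>x\<in>points C. \<pi> x = chart_inv c' (z a) \<longrightarrow> (\<exists>\<gamma>. L a b \<gamma> \<and> \<gamma> a = x)"
    using ab
  proof (induction rule: Bolzano)
    case (trans a b e)
    show ?case
    proof safe
      fix x assume "x \<in> points C" "\<pi> x = chart_inv c' (z a)"
      then obtain \<gamma> where \<gamma>: "L a b \<gamma>" "\<gamma> a = x" using trans(1) by blast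
      then have "\<gamma> b \<in> points C" "\<pi> (\<gamma> b) = chart_inv c' (z b)"
        using \<open>a \<le> b\<close> by (auto simp: L_def continuous_map_def)
      then obtain \<eta> where \<eta>: "L b e \<eta>" "\<eta> b = \<gamma> b" using trans(2) by blast
      define \<zeta> where "\<zeta> t = (if t \<le> b then \<gamma> t else \<eta> t)" for t
      have "L a e \<zeta>"
        unfolding L_def
      proof (intro conjI ballI)
        have "{x. x \<in> topspace (top_of_set {a..e}) \<and> x \<le> b} = {a..b}"
          "{x. x \<in> topspace (top_of_set {a..e}) \<and> b \<le> x} = {b..e}" "{a..e} \<inter> {a..b} = {a..b}"
          "{a..e} \<inter> {b..e} = {b..e}"
          using trans(3,4) by auto
        then show "continuous_map (top_of_set {a..e}) (curve_top C) \<zeta>"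
          unfolding \<zeta>_def using \<gamma> \<eta>
          by (intro continuous_map_cases_le) (auto simp: L_def subtopology_subtopology)
        show "\<pi> (\<zeta> t) = chart_inv c' (z t)" if "t \<in> {a..e}" for t
          using \<gamma> \<eta> that by (auto simp: L_def \<zeta>_def)
        have "continuous_on {a..e} (\<lambda>t. if t \<le> b then quot c' (\<gamma> t) else quot c' (\<eta> t))"
        proof (rule continuous_on_cases_le)
          show "continuous_on {t \<in> {a..e}. t \<le> b} (\<lambda>t. quot c' (\<gamma> t))"
            using \<gamma> unfolding L_def by (auto intro: continuous_on_subset)
          show "continuous_on {t \<in> {a..e}. b \<le> t} (\<lambda>t. quot c' (\<eta> t))"
            using \<eta> unfolding L_def by (auto intro: continuous_on_subset)
        qed (use \<eta> in auto)
        then show "continuous_on {a..e} (\<lambda>t. quot c' (\<zeta> t))"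
          by (simp add: \<zeta>_def if_distrib cong: if_cong)
      qed
      moreover have "\<zeta> a = x" using \<gamma> trans(3) by (simp add: \<zeta>_def)
      ultimately show "\<exists>\<gamma>. L a e \<gamma> \<and> \<gamma> a = x" by blast
    qed
  next
    case (local t)
    obtain p where p: "z t = snd c' p" "p \<in> fst c' - set ps" using z(2) by blast
    obtain y where y: "y \<in> points C" "\<pi> y = p"
      using proj_onto chart_subset[OF rs_C' c'] p(2) by (metis DiffD1 imageE subsetD)
    obtain c where c: "c \<in> atlas C" "y \<in> fst c" using obtain_chart[OF rs_C y(1)] .
    have p': "\<pi> y \<in> fst c'" "\<pi> y \<notin> set ps" using p y by auto
    obtain V s where V: "open V" "snd c' (\<pi> y) \<in> V" "V \<subseteq> snd c' ` (fst c' - set ps)"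
      "s holomorphic_on V" "s ` V \<subseteq> snd c ` fst c"
      "\<And>z. z \<in> V \<Longrightarrow> \<pi> (chart_inv c (s z)) = chart_inv c' z"
      "\<And>z. z \<in> V \<Longrightarrow> deriv (coord_expr c \<pi> c') (s z) \<noteq> 0"
      "coord_expr c \<pi> c' holomorphic_on s ` V" "open (s ` V)"
      using local_section[OF c c' p'] by metis
    note q = quot_section_holomorphic[OF c(1) c' V(1,3-)]
    have "open (z -` V)" using z(1) V(1) by (simp add: continuous_on_open_vimage)
    moreover have "t \<in> z -` V" using V(2) p(1) y(2) by simp
    ultimately obtain \<delta> where \<delta>: "0 < \<delta>" "ball t \<delta> \<subseteq> z -` V" using openE by blast
    have "\<exists>\<gamma>. L a b \<gamma> \<and> \<gamma> a = x"
      if ab: "a \<le> t" "t \<le> b" "b - a < \<delta>" and x: "x \<in> points C" "\<pi> x = chart_inv c' (z a)" for a b x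
    proof -
      have zV: "z u \<in> V" if "u \<in> {a..b}" for u
      proof -
        have "u \<in> ball t \<delta>" using that ab by (auto simp: dist_real_def)
        then show ?thesis using \<delta>(2) by auto
      qed
      have inC: "chart_inv c (s v) \<in> points C" if "v \<in> V" for v
        using that V(5) chart_inv_in[of "s v" c] chart_subset[OF rs_C c(1)] by blast
      have "z a \<in> V" using zV ab by auto
      then have "\<pi> x = \<pi> (chart_inv c (s (z a)))" using x V(6) by simp
      then obtain g where g: "g \<in> G" "x = \<rho> g (chart_inv c (s (z a)))"
        using proj_eq_iff x(1) inC \<open>z a \<in> V\<close> by metis
      define \<gamma> where "\<gamma> u = \<rho> g (chart_inv c (s (z u)))" for u
      have cont: "continuous_on {a..b} (\<lambda>u. s (z u))"
        by (rule continuous_on_compose2[OF holomorphic_on_imp_continuous_on[OF V(4)]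
              continuous_on_subset[OF z(1)]]) (use zV in auto)
      have q\<gamma>: "quot c' (\<gamma> u) = \<psi> (- g mod int d) * quot c' (chart_inv c (s (z u)))"
        if u: "u \<in> {a..b}" for u
      proof -
        obtain p1 where "p1 \<in> fst c' - set ps" "z u = snd c' p1" using V(3) zV[OF u] by blast
        then have "\<pi> (chart_inv c (s (z u))) \<in> fst c' - set ps"
          using V(6)[OF zV[OF u]] chart_inv_chart[OF rs_C' c'] by auto
        then show ?thesis
          unfolding \<gamma>_def using quot_act[OF g(1) inC[OF zV[OF u]] c'] by auto
      qed
      have "continuous_on {a..b} (\<lambda>u. \<psi> (- g mod int d) * quot c' (chart_inv c (s (z u))))"
        by (intro continuous_on_mult_left
              continuous_on_compose2[OF holomorphic_on_imp_continuous_on[OF q(1)]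
                continuous_on_subset[OF z(1)]]) (use zV in auto)
      then have cont_q: "continuous_on {a..b} (\<lambda>u. quot c' (\<gamma> u))"
        by (rule continuous_on_eq) (use q\<gamma> in simp)
      have "continuous_map (top_of_set {a..b}) (top_of_set (snd c ` fst c)) (\<lambda>u. s (z u))"
        using cont V(5) zV by (auto simp: image_subset_iff)
      then have "continuous_map (top_of_set {a..b}) (curve_top C) (\<rho> g \<circ> (chart_inv c \<circ> (\<lambda>u. s (z u))))"
        using continuous_map_chart_inv[OF rs_C c(1)] holomorphic_act[OF g(1)]
        unfolding holomorphic_map_def by (meson continuous_map_compose)
      moreover have "\<pi> (\<gamma> u) = chart_inv c' (z u)" if "u \<in> {a..b}" for u
        using proj_act[OF g(1) inC] V(6) zV[OF that] by (simp add: \<gamma>_def)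
      moreover have "\<rho> g \<circ> (chart_inv c \<circ> (\<lambda>u. s (z u))) = \<gamma>"
        by (simp add: fun_eq_iff \<gamma>_def)
      ultimately have "L a b \<gamma>"
        unfolding L_def using cont_q by auto
      then show ?thesis using g(2) \<gamma>_def by auto
    qed
    then show ?case using \<delta>(1) by blast
  qed
  then show ?thesis using x that unfolding L_def by blast
qed

end

text \<open>Along a circle, a \<open>d\<close>-th root of \<open>(z - w) ^ (M - d) * g z\<close> with \<open>g\<close> free of zeros is multiplied
  by \<open>exp (2 \<pi> i M / d)\<close>: divided by \<open>(z - w) powr (M / d - 1) * g z powr (1 / d)\<close>, continued along
  the circle, it takes values in a finite set.\<close>

lemma root_along_circle:
  fixes f :: "real \<Rightarrow> complex"
  assumes f: "continuous_on {0..1} f" and g: "g holomorphic_on ball w r"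
    and g0: "\<And>z. z \<in> ball w r \<Longrightarrow> g z \<noteq> 0" and \<epsilon>: "0 < \<epsilon>" "\<epsilon> < r" and d: "0 < d"
    and eq: "\<And>t. t \<in> {0..1} \<Longrightarrow> (of_real \<epsilon> * cis (2 * pi * t)) ^ d * f t ^ d =
      (of_real \<epsilon> * cis (2 * pi * t)) ^ M * g (w + of_real \<epsilon> * cis (2 * pi * t))"
  shows "f 1 = cis (2 * pi * (real M / real d)) * f 0" "f 0 \<noteq> 0"
proof -
  obtain k where k: "k holomorphic_on ball w r" "\<And>z. z \<in> ball w r \<Longrightarrow> g z = exp (k z)"
    using contractible_imp_holomorphic_log[OF g convex_imp_contractible[OF convex_ball]] g0 by metis
  define z where "z t = w + of_real \<epsilon> * cis (2 * pi * t)" for t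
  have z: "z t \<in> ball w r" for t
    using \<epsilon> by (simp add: z_def dist_norm norm_mult)
  define R where "R t = f t * cis (2 * pi * t) * cis (- (2 * pi * t * real M / real d)) *
    exp (- k (z t) / of_nat d)" for t
  have R: "R t ^ d = of_real \<epsilon> ^ M / of_real \<epsilon> ^ d" if t: "t \<in> {0..1}" for t
  proof -
    have gz: "g (w + of_real \<epsilon> * cis (2 * pi * t)) = exp (k (z t))"
      using k(2)[OF z[of t]] by (simp only: z_def)
    then have 1: "of_real \<epsilon> ^ d * (f t ^ d * cis (2 * pi * t) ^ d) =
        of_real \<epsilon> ^ M * cis (2 * pi * t) ^ M * exp (k (z t))"
      using eq[OF t] unfolding gz by (simp add: power_mult_distrib mult_ac)
    have 2: "exp (- k (z t) / of_nat d) ^ d = exp (- k (z t))"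
      using d by (simp flip: exp_of_nat_mult)
    have 3: "cis (- (2 * pi * t * real M / real d)) ^ d = cis (- (2 * pi * t * real M))"
      using d by (simp add: Complex.DeMoivre)
    have 4: "cis (2 * pi * t) ^ M * cis (- (2 * pi * t * real M)) = 1"
      by (simp add: Complex.DeMoivre cis_mult mult.commute)
    have 5: "exp (k (z t)) * exp (- k (z t)) = 1" by (simp flip: exp_add)
    have "of_real \<epsilon> ^ d * R t ^ d = (of_real \<epsilon> ^ d * (f t ^ d * cis (2 * pi * t) ^ d)) *
        (cis (- (2 * pi * t * real M)) * exp (- k (z t)))"
      unfolding R_def power_mult_distrib 2 3 by (simp only: mult_ac)
    also have "\<dots> = of_real \<epsilon> ^ M * (cis (2 * pi * t) ^ M * cis (- (2 * pi * t * real M))) *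
        (exp (k (z t)) * exp (- k (z t)))"
      unfolding 1 by (simp only: mult_ac)
    also have "\<dots> = of_real \<epsilon> ^ M" by (simp only: 4 5 mult_1_right)
    finally have "of_real \<epsilon> ^ d * R t ^ d = of_real \<epsilon> ^ M" .
    then show ?thesis using \<epsilon> by (simp add: field_simps)
  qed
  have cz: "continuous_on {0..1} (\<lambda>t. k (z t))"
    by (rule continuous_on_compose2[OF holomorphic_on_imp_continuous_on[OF k(1)], of _ z])
      (use z in \<open>auto simp: z_def[abs_def] intro!: continuous_intros\<close>)
  have "continuous_on {0..1} R"
    unfolding R_def using d by (intro continuous_intros f cz) auto
  moreover have "finite (R ` {0..1})"
    using finite_nth_roots[OF d, of "of_real \<epsilon> ^ M / of_real \<epsilon> ^ d"] R
    by (rule_tac finite_subset[rotated]) auto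
  ultimately have "R constant_on {0..1}"
    using continuous_finite_range_constant[OF connected_Icc] by blast
  then have "R 0 = R 1" by (auto simp: constant_on_def)
  \<comment> \<open>The circle closes, so at both ends the factors \<open>cis (2 * pi * t)\<close>
    and \<open>exp (- k (z t) / of_nat d)\<close> agree and only the fractional power has
    changed.\<close>
  then have "f 0 * exp (- k (z 0) / of_nat d) =
     f 1 * cis (- (2 * pi * (real M / real d))) * exp (- k (z 0) / of_nat d)"
    by (simp add: R_def z_def)
  then have "f 0 = f 1 * cis (- (2 * pi * (real M / real d)))" by simp
  then have "cis (2 * pi * (real M / real d)) * f 0 =
      f 1 * (cis (2 * pi * (real M / real d)) * cis (- (2 * pi * (real M / real d))))"
    by (simp only: mult_ac)
  then show "f 1 = cis (2 * pi * (real M / real d)) * f 0" by (simp add: cis_mult)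
  show "f 0 \<noteq> 0"
    using R[of 0] \<epsilon> d by (auto simp: R_def zero_power)
qed

lemma cis_fraction_eq:
  assumes "0 < d" "cis (2 * pi * (real_of_int a / real d)) = cis (2 * pi * (real_of_int b / real d))"
  shows "int d dvd a - b"
proof -
  obtain m :: int where m: "2 * pi * (real_of_int a / real d) =
      2 * pi * (real_of_int b / real d) + 2 * pi * real_of_int m"
    using assms(2) sin_cos_eq_iff by (metis cis.simps)
  have m': "2 * pi * (real_of_int a / real d) = 2 * pi * (real_of_int b / real d + real_of_int m)"
    using m by (simp only: distrib_left)
  have "real_of_int a / real d = real_of_int b / real d + real_of_int m"
    by (rule mult_left_cancel[THEN iffD1, OF _ m']) simp
  then have "real_of_int a = real_of_int (b + m * int d)"
    using assms(1) by (simp add: field_simps)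
  then show ?thesis by (simp only: of_int_eq_iff) simp
qed

section \<open>Pole orders at the branch points\<close>

context eigendifferential begin

text \<open>Multiplied by the \<open>d\<close>-th power of the coordinate, \<open>descent\<close>
  becomes holomorphic, and it is either zero or has a zero of some order \<open>M > 0\<close>.
  Around a small circle \<open>quot\<close> picks up \<open>exp (2 \<pi> i M / d)\<close> by
  \<open>root_along_circle\<close> and \<open>\<psi> (- \<theta> mod int d)\<close> by the local
  monodromy \<open>\<theta>\<close>. Hence \<open>M\<close> is congruent to
  \<open>- n \<theta>\<close> modulo \<open>d\<close>, which bounds the pole order
  \<open>d - M\<close> of \<open>descent\<close> by \<open>n \<theta> mod d\<close>.\<close>

lemma descent_order:
  assumes c': "c' \<in> atlas C'" "ps ! i \<in> fst c'" and i: "i < length \<Theta>"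
  shows "\<exists>B. eventually (\<lambda>w. norm ((w - snd c' (ps ! i)) ^ nat (int n * \<Theta> ! i mod int d) *
    descent c' w) \<le> B) (at (snd c' (ps ! i)))"
proof -
  let ?p = "ps ! i" and ?w = "snd c' (ps ! i)" and ?\<theta> = "\<Theta> ! i"
  define e where "e = nat (int n * ?\<theta> mod int d)"
  let ?V = "snd c' ` (fst c' - set (removeAll ?p ps))"
  have "openin (curve_top C') (fst c' - set (removeAll ?p ps))"
    using chart_openin[OF rs_C' c'(1)] by (rule openin_off_branch) auto
  then have "open ?V" by (rule open_chart_image_openin[OF rs_C' c'(1)]) auto
  moreover have "?w \<in> ?V" using c' by auto
  ultimately obtain r0 where r0: "0 < r0" "ball ?w r0 \<subseteq> ?V" using openE by blast
  have off: "u \<in> snd c' ` (fst c' - set ps)" if u: "u \<in> ball ?w r0 - {?w}" for u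
  proof -
    obtain q where "u = snd c' q" "q \<in> fst c' - set (removeAll ?p ps)" using r0(2) u by blast
    then show ?thesis using u by auto
  qed
  define H where "H u = (if u = ?w then 0 else (u - ?w) ^ d * descent c' u)" for u
  have "descent c' holomorphic_on ball ?w r0 - {?w}"
    by (rule holomorphic_on_subset[OF descent_holomorphic[OF c'(1)]]) (use off in blast)
  then have "(\<lambda>u. (u - ?w) ^ d * descent c' u) holomorphic_on ball ?w r0 - {?w}"
    by (intro holomorphic_intros)
  then have H: "H holomorphic_on ball ?w r0"
    unfolding H_def by (rule removable_singularity[OF _ open_ball descent_growth[OF c']])
  show ?thesis
    unfolding e_def[symmetric]
  proof (cases "H constant_on ball ?w r0")
    case True
    then obtain k where k: "\<And>u. u \<in> ball ?w r0 \<Longrightarrow> H u = k" unfolding constant_on_def by blast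
    then have "k = 0" using k[of ?w] r0(1) by (simp add: H_def)
    then have "descent c' u = 0" if "u \<in> ball ?w r0" "u \<noteq> ?w" for u
      using k[OF that(1)] that(2) by (simp add: H_def)
    then have "eventually (\<lambda>u. norm ((u - ?w) ^ e * descent c' u) \<le> 0) (at ?w)"
      unfolding eventually_at_topological using r0(1)
      by (intro exI[of _ "ball ?w r0"]) auto
    then show "\<exists>B. eventually (\<lambda>u. norm ((u - ?w) ^ e * descent c' u) \<le> B) (at ?w)" ..
  next
    case False
    obtain g r M where g: "0 < (M::nat)" "0 < r" "ball ?w r \<subseteq> ball ?w r0" "g holomorphic_on ball ?w r"
      "\<And>u. u \<in> ball ?w r \<Longrightarrow> H u = (u - ?w) ^ M * g u"
      "\<And>u. u \<in> ball ?w r \<Longrightarrow> g u \<noteq> 0"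
    proof (rule holomorphic_factor_zero_nonconstant[OF H open_ball connected_ball, of ?w])
      show "?w \<in> ball ?w r0" "H ?w = 0" using r0(1) by (auto simp: H_def)
    qed (use False that in auto)
    define \<epsilon> where "\<epsilon> = r / 2"
    have \<epsilon>: "0 < \<epsilon>" "\<epsilon> < r" using g(2) by (auto simp: \<epsilon>_def)
    define z where "z t = ?w + of_real \<epsilon> * cis (2 * pi * t)" for t
    have z: "z t \<in> ball ?w r" "z t \<noteq> ?w" for t
      using \<epsilon> by (auto simp: z_def dist_norm norm_mult)
    have zV: "z t \<in> snd c' ` (fst c' - set ps)" for t
      using off z g(3) by blast
    have z': "chart_inv c' (z t) \<in> fst c'" "chart_inv c' (z t) \<notin> set ps"
      "snd c' (chart_inv c' (z t)) = z t" for t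
      using zV[of t] chart_inv_chart[OF rs_C' c'(1)] by auto
    have cz: "continuous_on UNIV z" unfolding z_def[abs_def] by (intro continuous_intros)
    obtain x where x: "x \<in> points C" "\<pi> x = chart_inv c' (z 0)"
      using proj_onto chart_subset[OF rs_C' c'(1)] z'(1)[of 0] by (metis imageE subsetD)
    obtain \<gamma> where \<gamma>: "continuous_map (top_of_set {0..1}) (curve_top C) \<gamma>" "\<gamma> 0 = x"
      "\<And>t. t \<in> {0..1} \<Longrightarrow> \<pi> (\<gamma> t) = chart_inv c' (z t)"
      "continuous_on {0..1} (\<lambda>t. quot c' (\<gamma> t))"
      using path_lift[OF c'(1) cz _ _ x, of 1] zV by auto
    have inC: "\<gamma> t \<in> points C" if "t \<in> {0..1}" for t
      using \<gamma>(1) that by (auto simp: continuous_map_def)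
    have \<theta>: "?\<theta> \<in> G" using monodromy_in i by (auto dest: nth_mem)
    \<comment> \<open>The disc of radius \<open>r0\<close> contains no other branch point, so this
      circle is among the loops quantified over in \<open>local_monodromy\<close>.\<close>
    have "\<gamma> 1 = \<rho> ?\<theta> (\<gamma> 0)"
    proof -
      have "cball ?w \<epsilon> \<subseteq> ball ?w r0" using \<epsilon>(2) g(3) cball_subset_ball_iff[of ?w \<epsilon> ?w r] by auto
      moreover have "q = ?p" if q: "q \<in> set ps" "q \<in> fst c'" "snd c' q \<in> ball ?w r0" for q
      proof -
        obtain q' where q': "snd c' q = snd c' q'" "q' \<in> fst c' - set (removeAll ?p ps)"
          using r0(2) q(3) by blast
        then have "q = q'" using inj_on_chart[OF rs_C' c'(1)] q(2) by (metis DiffD1 inj_onD)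
        then show ?thesis using q' q(1) by auto
      qed
      moreover have "ball ?w r0 \<subseteq> snd c' ` fst c'" using r0(2) by blast
      ultimately have "?p \<in> fst c' \<and> cball ?w \<epsilon> \<subseteq> snd c' ` fst c' \<and>
          (\<forall>q\<in>set ps. q \<in> fst c' \<and> snd c' q \<in> cball ?w \<epsilon> \<longrightarrow> q = ?p) \<and>
          pathin (curve_top C) \<gamma> \<and>
          (\<forall>t\<in>{0..1}. \<pi> (\<gamma> t) = chart_inv c' (?w + of_real \<epsilon> * cis (2 * pi * t)))"
        using c'(2) \<gamma>(1,3) unfolding pathin_def z_def by blast
      then show ?thesis
        by (rule monodromy[OF i, unfolded local_monodromy_def, rule_format, OF c'(1) \<epsilon>(1)])
    qed
    then have 1: "quot c' (\<gamma> 1) = \<psi> (- ?\<theta> mod int d) * quot c' (\<gamma> 0)"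
      using quot_act[OF \<theta> inC c'(1)] \<gamma>(3)[of 0] z' by simp
    have des: "descent c' (z t) = quot c' (\<gamma> t) ^ d" if "t \<in> {0..1}" for t
      using descent_eq[OF inC[OF that] c'(1)] \<gamma>(3)[OF that] z'[of t] by simp
    have eq: "(of_real \<epsilon> * cis (2 * pi * t)) ^ d * quot c' (\<gamma> t) ^ d =
      (of_real \<epsilon> * cis (2 * pi * t)) ^ M * g (?w + of_real \<epsilon> * cis (2 * pi * t))"
      if "t \<in> {0..1}" for t
      using g(5)[OF z(1)[of t]] z(2)[of t] des[OF that] by (simp add: H_def) (simp add: z_def)
    note root = root_along_circle[OF \<gamma>(4) g(4,6) \<epsilon> d_pos eq]
    have "- ?\<theta> mod int d \<in> G" using d_pos by (simp add: G_eq)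
    then have "cis (2 * pi * (real_of_int (int M) / real d)) =
        cis (2 * pi * (real_of_int (int n * (- ?\<theta> mod int d)) / real d))"
      using root 1 by (simp add: character)
    then have "int d dvd int M - int n * (- ?\<theta> mod int d)"
      by (rule cis_fraction_eq[OF d_pos])
    then have "int M mod int d = int n * (- ?\<theta> mod int d) mod int d"
      by (simp add: mod_eq_dvd_iff)
    also have "\<dots> = (- (int n * ?\<theta>)) mod int d" by (simp add: mod_mult_right_eq)
    finally have "int d dvd int M - (- (int n * ?\<theta>))" by (simp only: mod_eq_dvd_iff)
    then have "int d dvd int M + int n * ?\<theta> mod int d"
      by (simp add: dvd_eq_mod_eq_0 mod_add_right_eq)
    moreover have "0 \<le> int n * ?\<theta> mod int d" using d_pos by simp
    ultimately have "int d dvd int (M + e)" by (simp add: e_def)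
    \<comment> \<open>As \<open>M\<close> is positive, the multiple \<open>M + e\<close> of
      \<open>d\<close> is not 0, even if \<open>e\<close> is 0.\<close>
    then have "d \<le> M + e" using g(1) by (intro dvd_imp_le) (auto simp only: int_dvd_int_iff)
    then have eq': "(u - ?w) ^ e * descent c' u = (u - ?w) ^ (M + e - d) * g u"
      if "u \<in> ball ?w r" "u \<noteq> ?w" for u
    proof -
      have "(u - ?w) ^ d * ((u - ?w) ^ e * descent c' u) = (u - ?w) ^ e * H u"
        using that(2) by (simp add: H_def)
      also have "\<dots> = (u - ?w) ^ (M + e) * g u"
        using g(5)[OF that(1)] by (simp add: power_add)
      also have "\<dots> = (u - ?w) ^ d * ((u - ?w) ^ (M + e - d) * g u)"
        using \<open>d \<le> M + e\<close> by (simp flip: power_add mult.assoc)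
      finally show ?thesis using that(2) by simp
    qed
    have "isCont g ?w"
      using g(2,4) by (meson centre_in_ball continuous_on_eq_continuous_at
          holomorphic_on_imp_continuous_on open_ball)
    then have "isCont (\<lambda>u. norm ((u - ?w) ^ (M + e - d) * g u)) ?w"
      by (intro continuous_intros)
    then obtain B where "((\<lambda>u. norm ((u - ?w) ^ (M + e - d) * g u)) \<longlongrightarrow> B) (at ?w)"
      unfolding isCont_def by blast
    then have "eventually (\<lambda>u. norm ((u - ?w) ^ (M + e - d) * g u) < B + 1) (at ?w)"
      by (rule order_tendstoD) simp
    moreover have "eventually (\<lambda>u. u \<in> ball ?w r - {?w}) (at ?w)"
      using g(2) by (intro eventually_at_in_open) auto
    ultimately have "eventually (\<lambda>u. norm ((u - ?w) ^ e * descent c' u) \<le> B + 1) (at ?w)"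
      by eventually_elim (use eq' in auto)
    then show "\<exists>B. eventually (\<lambda>u. norm ((u - ?w) ^ e * descent c' u) \<le> B) (at ?w)" ..
  qed
qed

end

subsection \<open>Coverings of the projective line\<close>

lemma bounded_times_null:
  fixes f g :: "'a :: topological_space \<Rightarrow> complex"
  assumes "eventually (\<lambda>z. norm (f z) \<le> B) F" "(g \<longlongrightarrow> 0) F"
  shows "((\<lambda>z. f z * g z) \<longlongrightarrow> 0) F"
proof -
  have "Bfun f F" using assms(1) unfolding Bfun_def
    by (intro exI[of _ "max B 1"]) (auto elim: eventually_mono)
  then show ?thesis
    using bounded_bilinear.Bfun_prod_Zfun[OF bounded_bilinear_mult] assms(2)
    by (simp add: tendsto_Zfun_iff)
qed

text \<open>Riemann's theorem removes one point at a time. The bound near each remaining point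
  passes to the extension, which agrees with \<open>f\<close> in a punctured neighbourhood of
  it.\<close>

lemma extend_over_finite:
  fixes f :: "complex \<Rightarrow> complex"
  assumes "finite F" "f holomorphic_on - F"
    and "\<And>a. a \<in> F \<Longrightarrow> \<exists>B. eventually (\<lambda>z. norm (f z) \<le> B) (at a)"
  obtains g where "g holomorphic_on UNIV" "\<And>z. z \<notin> F \<Longrightarrow> g z = f z"
proof -
  have "\<exists>g. g holomorphic_on UNIV \<and> (\<forall>z. z \<notin> F \<longrightarrow> g z = f z)"
    using assms
  proof (induction arbitrary: f rule: finite_induct)
    case empty
    then show ?case by (auto simp: Compl_eq_Diff_UNIV)
  next
    case (insert a F)
    have F: "open (- F)" using insert(1) by (simp add: finite_imp_closed open_Compl)
    obtain B where B: "eventually (\<lambda>z. norm (f z) \<le> B) (at a)" using insert(5) by blast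
    have "((\<lambda>z. z - a) \<longlongrightarrow> 0) (at a)" by (auto intro!: tendsto_eq_intros)
    then have "((\<lambda>z. (z - a) * f z) \<longlongrightarrow> 0) (at a)"
      using bounded_times_null[OF B, of "\<lambda>z. z - a"] by (simp add: mult.commute)
    moreover have "f holomorphic_on - F - {a}"
      using insert(4) by (rule holomorphic_on_subset) auto
    moreover have "a \<in> interior (- F)" using F insert(2) by (simp add: interior_open)
    ultimately obtain g where g: "g holomorphic_on - F" "\<And>z. z \<in> - F - {a} \<Longrightarrow> g z = f z"
      using holomorphic_on_extend_lim[of f "- F" a] by blast
    have "\<exists>B. eventually (\<lambda>z. norm (g z) \<le> B) (at b)" if b: "b \<in> F" for b
    proof -
      obtain B where B: "eventually (\<lambda>z. norm (f z) \<le> B) (at b)" using insert(5) b by blast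
      have "open (- (insert a F - {b}))" using insert(1) by (intro open_Compl finite_imp_closed) auto
      then have "eventually (\<lambda>z. z \<in> - (insert a F - {b}) - {b}) (at b)"
        using b by (intro eventually_at_in_open) auto
      with B have "eventually (\<lambda>z. norm (g z) \<le> B) (at b)"
        by eventually_elim (use g(2) in auto)
      then show ?thesis ..
    qed
    then obtain h where "h holomorphic_on UNIV" "\<And>z. z \<notin> F \<Longrightarrow> h z = g z"
      using insert(3)[OF g(1)] by blast
    then show ?case using g(2) by (intro exI[of _ h]) auto
  qed
  then show ?thesis using that by blast
qed

section \<open>The two standard charts of the projective line\<close>

definition affine_chart :: "complex option chart" where
  "affine_chart = (range Some, the)"

definition infinity_chart :: "complex option chart" where
  "infinity_chart = (- {Some 0}, \<lambda>x. case x of None \<Rightarrow> 0 | Some z \<Rightarrow> 1 / z)"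

lemma
  shows affine_chart_atlas: "affine_chart \<in> atlas projective_line"
    and infinity_chart_atlas: "infinity_chart \<in> atlas projective_line"
    and fst_affine_chart: "fst affine_chart = range Some"
    and snd_affine_chart: "snd affine_chart = the"
    and fst_infinity_chart: "fst infinity_chart = - {Some 0}"
    and snd_infinity_chart: "snd infinity_chart = (\<lambda>x. case x of None \<Rightarrow> 0 | Some z \<Rightarrow> 1 / z)"
  by (auto simp: affine_chart_def infinity_chart_def projective_line_def)

lemma affine_chart_inv: "chart_inv affine_chart z = Some z"
proof -
  have "inj_on the (range (Some :: complex \<Rightarrow> complex option))" by (auto simp: inj_on_def)
  then show ?thesis
    using inv_into_f_f[of the "range Some" "Some z"] by (simp add: affine_chart_def)
qed

context eigendifferential begin

lemma quot_change_chart: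
  assumes c': "c' \<in> atlas C'" "\<pi> x \<in> fst c'" and k: "k \<in> atlas C'" "\<pi> x \<in> fst k"
    and x: "x \<in> points C" "\<pi> x \<notin> set ps"
  shows "quot c' x = quot k x * deriv (coord_expr c' (\<lambda>x. x) k) (snd c' (\<pi> x))"
proof -
  obtain c where c: "c \<in> atlas C" "x \<in> fst c" using obtain_chart[OF rs_C x(1)] .
  have "deriv (coord_expr c \<pi> k) (snd c x) =
      deriv (coord_expr c' (\<lambda>x. x) k) (snd c' (\<pi> x)) * deriv (coord_expr c \<pi> c') (snd c x)"
    using c c' k by (intro deriv_coord_expr_comp[OF rs_C rs_C' rs_C' holomorphic_proj holomorphic_map_id])
      (auto intro: rs_C')
  moreover have "quot c' x = \<omega> c x / deriv (coord_expr c \<pi> c') (snd c x)"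
    "quot k x = \<omega> c x / deriv (coord_expr c \<pi> k) (snd c x)"
    using quot_eq[OF c] c' k x by auto
  moreover have "deriv (coord_expr c \<pi> k) (snd c x) \<noteq> 0"
    using deriv_proj_nonzero[OF c k x(2)] .
  ultimately show ?thesis by simp
qed

lemma descent_isCont:
  assumes "c' \<in> atlas C'" "p \<in> fst c'" "p \<notin> set ps"
  shows "isCont (descent c') (snd c' p)"
proof -
  have "open (snd c' ` (fst c' - set ps))"
    using openin_off_branch[OF chart_openin[OF rs_C' assms(1)] subset_refl]
    by (rule open_chart_image_openin[OF rs_C' assms(1)]) auto
  then show ?thesis
    using holomorphic_on_imp_continuous_on[OF descent_holomorphic[OF assms(1)]] assms(2,3)
    by (simp add: continuous_on_eq_continuous_at)
qed

text \<open>The points over \<open>A\<close> are isolated because \<open>A\<close> and all fibres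
  are finite, so continuity forces the coefficients to vanish there too. Outside the charts they are
  0 by the convention in \<open>holomorphic_differentials\<close>.\<close>

lemma differential_eq_zero:
  assumes A: "finite A" and zero: "\<And>c x. c \<in> atlas C \<Longrightarrow> x \<in> fst c \<Longrightarrow> \<pi> x \<notin> A \<Longrightarrow> \<omega> c x = 0"
  shows "\<omega> = 0"
proof -
  have "\<omega> c x = 0" if c: "c \<in> atlas C" "x \<in> fst c" for c x
  proof -
    let ?f = "\<lambda>z. \<omega> c (chart_inv c z)" and ?S = "snd c ` fst c"
    let ?K = "snd c ` (\<Union>p\<in>A. {y \<in> points C. \<pi> y = p})"
    have S: "open ?S" "snd c x \<in> ?S" using open_chart_image[OF rs_C c(1)] c(2) by auto
    have "finite ?K" using A finite_fibre by blast
    then have "open (?S - (?K - {snd c x}))"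
      using S(1) by (intro open_Diff finite_imp_closed) auto
    then have "eventually (\<lambda>z. z \<in> ?S - (?K - {snd c x}) - {snd c x}) (at (snd c x))"
      using S(2) by (intro eventually_at_in_open) auto
    then have ev: "eventually (\<lambda>z. ?f z = 0) (at (snd c x))"
    proof eventually_elim
      case (elim z)
      then obtain y where y: "z = snd c y" "y \<in> fst c" by auto
      then have "y \<in> points C" using chart_subset[OF rs_C c(1)] by auto
      then have "\<pi> y \<notin> A" using elim y by auto
      then show ?case using zero[OF c(1) y(2)] y chart_inv_chart[OF rs_C c(1)] by simp
    qed
    have "isCont ?f (snd c x)"
      using holomorphic_on_imp_continuous_on[OF coefficient_holomorphic[OF c(1)]] S(1) c(2)
      by (simp add: continuous_on_eq_continuous_at)
    then have "((\<lambda>z. 0) \<longlongrightarrow> ?f (snd c x)) (at (snd c x))"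
      unfolding isCont_def using ev by (rule Lim_transform_eventually)
    then have "?f (snd c x) = 0" by (simp add: tendsto_const_iff)
    then show ?thesis using chart_inv_chart[OF rs_C c] by simp
  qed
  moreover have "\<omega> c x = 0" if "\<not> (c \<in> atlas C \<and> x \<in> fst c)" for c x
    using differential that unfolding holomorphic_differentials_def by blast
  ultimately have "\<omega> c x = 0" for c x by blast
  then show ?thesis by (simp add: fun_eq_iff)
qed

end

section \<open>Counting zeros and poles on the projective line\<close>

locale eigendifferential_line = eigendifferential d \<Theta> C \<rho> projective_line \<pi> ps n \<psi> \<omega>
  for d :: nat and \<Theta> :: "int list" and C :: "'a curve" and \<rho> :: "int \<Rightarrow> 'a \<Rightarrow> 'a"
    and \<pi> :: "'a \<Rightarrow> complex option" and ps :: "complex option list" and n \<psi> \<omega>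
begin

text \<open>The factor \<open>- (z\<^sup>2)\<close> is \<open>dz / dw\<close> for
  \<open>w = 1 / z\<close>; its \<open>d\<close>-th power accounts for the double pole of
  \<open>dz\<close> at infinity.\<close>

lemma descent_infinity_chart:
  assumes z: "z \<noteq> 0" "Some z \<notin> set ps"
  shows "descent infinity_chart (1 / z) = (- (z\<^sup>2)) ^ d * descent affine_chart z"
proof -
  have "Some z \<in> points projective_line"
    using chart_subset[OF rs_C' affine_chart_atlas] by (auto simp: fst_affine_chart)
  then obtain x where x: "x \<in> points C" "\<pi> x = Some z" using proj_onto by (metis imageE)
  have in_charts: "\<pi> x \<in> fst affine_chart" "\<pi> x \<in> fst infinity_chart" "\<pi> x \<notin> set ps"
    using x z by (auto simp: fst_affine_chart fst_infinity_chart)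
  have "coord_expr affine_chart (\<lambda>x. x) infinity_chart = (\<lambda>u. 1 / u)"
    by (auto simp: coord_expr_def affine_chart_inv snd_infinity_chart)
  moreover have "deriv (\<lambda>u. 1 / u) z = - (1 / z\<^sup>2)"
    using z(1) by (intro DERIV_imp_deriv)
      (auto intro!: derivative_eq_intros simp: power2_eq_square)
  ultimately have "quot affine_chart x = quot infinity_chart x * (- (1 / z\<^sup>2))"
    using quot_change_chart[OF affine_chart_atlas in_charts(1) infinity_chart_atlas in_charts(2) x(1)
        in_charts(3)] x(2) by (simp add: snd_affine_chart)
  then have "quot infinity_chart x = (- (z\<^sup>2)) * quot affine_chart x"
    using z(1) by (simp add: field_simps)
  moreover have "descent affine_chart z = quot affine_chart x ^ d"
    using descent_eq[OF x(1) affine_chart_atlas] in_charts x(2) by (simp add: snd_affine_chart)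
  moreover have "descent infinity_chart (1 / z) = quot infinity_chart x ^ d"
    using descent_eq[OF x(1) infinity_chart_atlas] in_charts x(2) by (simp add: snd_infinity_chart)
  ultimately show ?thesis by (simp only: power_mult_distrib)
qed

text \<open>By \<open>descent_order\<close>, the pole of \<open>descent\<close> at the branch point
  \<open>ps ! i\<close> has at most this order.\<close>

definition ord_bound :: "nat \<Rightarrow> nat" where
  "ord_bound i = nat (int n * \<Theta> ! i mod int d)"

definition finite_branch :: "nat set" where
  "finite_branch = {i. i < length \<Theta> \<and> ps ! i \<noteq> None}"

text \<open>The product cancels the possible poles at the branch points other than infinity, which
  leaves an entire function up to removable singularities.\<close>

definition cleared :: "complex \<Rightarrow> complex" where
  "cleared z = descent affine_chart z * (\<Prod>i\<in>finite_branch. (z - the (ps ! i)) ^ ord_bound i)"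

lemma finite_finite_branch: "finite finite_branch"
  by (simp add: finite_branch_def)

lemma cleared_holomorphic: "cleared holomorphic_on - {z. Some z \<in> set ps}"
proof -
  have "- {z. Some z \<in> set ps} = snd affine_chart ` (fst affine_chart - set ps)"
    by (force simp: fst_affine_chart snd_affine_chart image_iff)
  then show ?thesis
    using descent_holomorphic[OF affine_chart_atlas] unfolding cleared_def
    by (auto intro!: holomorphic_intros)
qed

lemma cleared_bounded:
  assumes "Some a \<in> set ps"
  shows "\<exists>B. eventually (\<lambda>z. norm (cleared z) \<le> B) (at a)"
proof -
  obtain i where i: "i < length \<Theta>" "ps ! i = Some a"
    using assms length_branch by (metis in_set_conv_nth)
  then have iI: "i \<in> finite_branch" by (simp add: finite_branch_def)
  let ?g = "\<lambda>z. \<Prod>j\<in>finite_branch - {i}. (z - the (ps ! j)) ^ ord_bound j"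
  obtain B where B: "eventually (\<lambda>z. norm ((z - a) ^ ord_bound i * descent affine_chart z) \<le> B) (at a)"
    using descent_order[OF affine_chart_atlas _ i(1)] i(2)
    by (auto simp: fst_affine_chart snd_affine_chart ord_bound_def)
  have "isCont (\<lambda>z. norm (?g z)) a" by (intro continuous_intros)
  then have "eventually (\<lambda>z. norm (?g z) < norm (?g a) + 1) (at a)"
    unfolding isCont_def by (rule order_tendstoD) simp
  with B have "eventually (\<lambda>z. norm (cleared z) \<le> B * (norm (?g a) + 1)) (at a)"
  proof eventually_elim
    case (elim z)
    have "cleared z = ((z - a) ^ ord_bound i * descent affine_chart z) * ?g z"
      unfolding cleared_def prod.remove[OF finite_finite_branch iI] by (simp add: i(2))
    then have "norm (cleared z) = norm ((z - a) ^ ord_bound i * descent affine_chart z) * norm (?g z)"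
      by (simp add: norm_mult)
    also have "\<dots> \<le> B * (norm (?g a) + 1)"
      using elim by (intro mult_mono) (auto intro: order_trans[OF norm_ge_zero])
    finally show ?case .
  qed
  then show ?thesis ..
qed

text \<open>\<open>k\<close> is the contribution of infinity to the total: its
  \<open>ord_bound\<close> if infinity is a branch point, and 0 otherwise, when
  \<open>descent\<close> is continuous there. Both cases can then be continued alike.\<close>

lemma descent_at_infinity:
  obtains k B where "k + (\<Sum>i\<in>finite_branch. ord_bound i) = (\<Sum>i<length \<Theta>. ord_bound i)"
    "eventually (\<lambda>w. norm (w ^ k * descent infinity_chart w) \<le> B) (at 0)"
proof (cases "None \<in> set ps")
  case True
  then obtain i where i: "i < length \<Theta>" "ps ! i = None"
    using length_branch by (metis in_set_conv_nth)
  have "{..<length \<Theta>} = insert i finite_branch"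
    using i nth_eq_iff_index_eq[OF distinct_branch] length_branch
    by (auto simp: finite_branch_def) (metis not_None_eq)
  moreover have "i \<notin> finite_branch" using i by (simp add: finite_branch_def)
  ultimately have "ord_bound i + (\<Sum>i\<in>finite_branch. ord_bound i) = (\<Sum>i<length \<Theta>. ord_bound i)"
    using finite_finite_branch by simp
  moreover obtain B where "eventually (\<lambda>w. norm (w ^ ord_bound i * descent infinity_chart w) \<le> B) (at 0)"
    using descent_order[OF infinity_chart_atlas _ i(1)] i(2)
    by (auto simp: fst_infinity_chart snd_infinity_chart ord_bound_def)
  ultimately show ?thesis by (rule that)
next
  case False
  then have "ps ! j \<noteq> None" if "j < length \<Theta>" for j
    using length_branch that by (metis nth_mem)
  then have "finite_branch = {..<length \<Theta>}"
    by (auto simp: finite_branch_def)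
  then have "0 + (\<Sum>i\<in>finite_branch. ord_bound i) = (\<Sum>i<length \<Theta>. ord_bound i)" by simp
  moreover have "isCont (descent infinity_chart) 0"
    using descent_isCont[OF infinity_chart_atlas, of None] False
    by (simp add: fst_infinity_chart snd_infinity_chart)
  then have "isCont (\<lambda>w. norm (descent infinity_chart w)) 0" by (intro continuous_intros)
  then have "eventually (\<lambda>w. norm (descent infinity_chart w) < norm (descent infinity_chart 0) + 1) (at 0)"
    unfolding isCont_def by (rule order_tendstoD) simp
  then have "eventually (\<lambda>w. norm (w ^ 0 * descent infinity_chart w) \<le> norm (descent infinity_chart 0) + 1) (at 0)"
    by eventually_elim simp
  ultimately show ?thesis by (rule that)
qed

text \<open>In the coordinate \<open>w = 1 / z\<close> the differential \<open>dz\<close>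
  contributes \<open>w ^ (2 * d)\<close> up to sign, and clearing the finite poles costs
  \<open>w ^ ?e\<close>. What remains is the bounded \<open>w ^ k * descent infinity_chart w\<close>
  times a continuous function and \<open>w ^ m\<close>, where \<open>m = 2 * d - ?e - k\<close> is
  positive by the degree assumption.\<close>

lemma cleared_at_infinity:
  assumes deg: "(\<Sum>i<length \<Theta>. int n * \<Theta> ! i mod int d) < 2 * int d"
  shows "((cleared \<circ> inverse) \<longlongrightarrow> 0) (at 0)"
proof -
  obtain k B where k: "k + (\<Sum>i\<in>finite_branch. ord_bound i) = (\<Sum>i<length \<Theta>. ord_bound i)"
    and B: "eventually (\<lambda>w. norm (w ^ k * descent infinity_chart w) \<le> B) (at 0)"
    using descent_at_infinity by blast
  have "int (\<Sum>i<length \<Theta>. ord_bound i) = (\<Sum>i<length \<Theta>. int n * \<Theta> ! i mod int d)"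
    using d_pos by (simp add: ord_bound_def)
  then have "(\<Sum>i<length \<Theta>. ord_bound i) < 2 * d" using deg by linarith
  then obtain m where m: "0 < m" "2 * d = (\<Sum>i<length \<Theta>. ord_bound i) + m"
    using less_imp_add_positive by metis
  let ?e = "\<Sum>i\<in>finite_branch. ord_bound i"
  let ?g = "\<lambda>w. (-1) ^ d * w ^ m * (\<Prod>i\<in>finite_branch. (1 - the (ps ! i) * w) ^ ord_bound i)"
  have "isCont ?g 0" by (intro continuous_intros)
  then have "(?g \<longlongrightarrow> 0) (at 0)" using m(1) unfolding isCont_def by (simp add: zero_power)
  then have lim: "((\<lambda>w. (w ^ k * descent infinity_chart w) * ?g w) \<longlongrightarrow> 0) (at 0)"
    using bounded_times_null[OF B] by blast
  have "finite ((inverse \<circ> the) ` set ps)" by simp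
  \<comment> \<open>Near 0 the inverses of the branch points are avoided. The value 0 is taken out
    because \<open>inverse 0 = 0\<close>: a branch point at the origin would otherwise exclude the
    centre.\<close>
  then have "open (- ((inverse \<circ> the) ` set ps - {0}))"
    by (intro open_Compl finite_imp_closed) auto
  then have "eventually (\<lambda>w. w \<in> - ((inverse \<circ> the) ` set ps - {0}) - {0}) (at 0)"
    by (intro eventually_at_in_open) auto
  then have "eventually (\<lambda>w. (w ^ k * descent infinity_chart w) * ?g w = (cleared \<circ> inverse) w) (at 0)"
  proof eventually_elim
    case (elim w)
    then have w: "w \<noteq> 0" "Some (inverse w) \<notin> set ps" by (force simp: image_iff)+
    have des: "descent infinity_chart w = (- ((inverse w)\<^sup>2)) ^ d * descent affine_chart (inverse w)"
      using descent_infinity_chart[OF _ w(2)] w(1) by (simp add: inverse_eq_divide)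
    have unit: "(-1) ^ d * w ^ (2 * d) * (- ((inverse w)\<^sup>2)) ^ d = 1"
    proof -
      have "(-1) ^ d * w ^ (2 * d) * (- ((inverse w)\<^sup>2)) ^ d = ((-1) * w\<^sup>2 * (- ((inverse w)\<^sup>2))) ^ d"
        by (simp only: power_mult power_mult_distrib)
      also have "(-1) * w\<^sup>2 * (- ((inverse w)\<^sup>2)) = 1"
        using w(1) by (simp add: power_inverse)
      finally show ?thesis by simp
    qed
    have 1: "(-1) ^ d * w ^ (2 * d) * descent infinity_chart w = descent affine_chart (inverse w)"
      by (simp only: des mult.assoc[symmetric] unit mult_1)
    have "(inverse w - a) ^ j * w ^ j = (1 - a * w) ^ j" for a j
      using w(1) by (simp add: left_diff_distrib flip: power_mult_distrib)
    then have "(\<Prod>i\<in>finite_branch. (1 - the (ps ! i) * w) ^ ord_bound i) =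
        (\<Prod>i\<in>finite_branch. (inverse w - the (ps ! i)) ^ ord_bound i) * w ^ ?e"
      by (simp add: power_sum flip: prod.distrib)
    then have "(w ^ k * descent infinity_chart w) * ?g w =
        ((-1) ^ d * w ^ (k + ?e + m) * descent infinity_chart w) *
          (\<Prod>i\<in>finite_branch. (inverse w - the (ps ! i)) ^ ord_bound i)"
      by (simp add: power_add mult_ac)
    also have "k + ?e + m = 2 * d" using k m by simp
    finally show ?case by (simp only: 1 cleared_def o_def)
  qed
  with lim show ?thesis by (rule Lim_transform_eventually)
qed

text \<open>The extension of \<open>cleared\<close> is entire and tends to 0 at infinity, so it is
  zero by Liouville. Away from infinity and the branch points the clearing product has no zero,
  hence \<open>quot\<close> and \<open>\<omega>\<close> vanish there, and
  \<open>differential_eq_zero\<close> covers the finitely many remaining fibres.\<close>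

theorem differential_vanishes:
  assumes deg: "(\<Sum>i<length \<Theta>. int n * \<Theta> ! i mod int d) < 2 * int d"
  shows "\<omega> = 0"
proof (rule differential_eq_zero)
  have fin: "finite {z. Some z \<in> set ps}"
    by (rule finite_subset[of _ "the ` set ps"]) (force simp: image_iff)+
  show "finite (insert None (set ps))" by simp
  obtain g where g: "g holomorphic_on UNIV" "\<And>z. z \<notin> {z. Some z \<in> set ps} \<Longrightarrow> g z = cleared z"
    using extend_over_finite[OF fin cleared_holomorphic] cleared_bounded by blast
  have "finite (inverse ` {z. Some z \<in> set ps})" using fin by simp
  then have "open (- (inverse ` {z. Some z \<in> set ps} - {0}))"
    by (intro open_Compl finite_imp_closed) auto
  then have "eventually (\<lambda>w. w \<in> - (inverse ` {z. Some z \<in> set ps} - {0}) - {0}) (at 0)"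
    by (intro eventually_at_in_open) auto
  then have ev: "eventually (\<lambda>w. (cleared \<circ> inverse) w = (g \<circ> inverse) w) (at 0)"
  proof eventually_elim
    case (elim w)
    then have "inverse w \<notin> {z. Some z \<in> set ps}" by (force simp: image_iff)
    then show ?case using g(2) by simp
  qed
  have "((g \<circ> inverse) \<longlongrightarrow> 0) (at 0)"
    using cleared_at_infinity[OF deg] ev by (rule Lim_transform_eventually)
  then have "(g \<longlongrightarrow> 0) at_infinity" by (simp add: lim_at_infinity_0)
  then have g0: "g z = 0" for z using Liouville_weak[OF g(1)] by blast
  fix c x assume c: "c \<in> atlas C" "x \<in> fst c" and x: "\<pi> x \<notin> insert None (set ps)"
  then obtain z where z: "\<pi> x = Some z" by auto
  then have "cleared z = 0" using g(2)[of z] g0 x by auto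
  moreover have "z - the (ps ! i) \<noteq> 0" if "i \<in> finite_branch" for i
  proof
    assume "z - the (ps ! i) = 0"
    then have "ps ! i = Some z" using that by (auto simp: finite_branch_def)
    then show False using that x z length_branch by (auto simp: finite_branch_def) (metis nth_mem)
  qed
  ultimately have "descent affine_chart z = 0"
    using finite_finite_branch by (auto simp: cleared_def)
  moreover have in_chart: "\<pi> x \<in> fst affine_chart" "\<pi> x \<notin> set ps"
    using z x by (auto simp: fst_affine_chart)
  moreover have "x \<in> points C" using c chart_subset[OF rs_C] by blast
  ultimately have "quot affine_chart x = 0"
    using descent_eq[OF _ affine_chart_atlas in_chart] z by (simp add: snd_affine_chart)
  then show "\<omega> c x = 0"
    using quot_eq[OF c affine_chart_atlas in_chart] deriv_proj_nonzero[OF c affine_chart_atlas in_chart]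
    by simp
qed

end

subsection \<open>Characters and the numerical criterion\<close>

text \<open>The value \<open>u\<close> at the generator determines the character, and going once
  around the group gives \<open>u ^ d = 1\<close>; \<open>n\<close> is the exponent of this root of
  unity.\<close>

lemma irreducible_character_index:
  assumes d: "0 < d" and \<psi>: "\<psi> \<in> irreducible_characters d"
  obtains n where "n < d" "\<And>g. g \<in> carrier (integer_mod_group d) \<Longrightarrow>
    \<psi> g = cis (2 * pi * (real n * real_of_int g / real d))"
proof -
  have G: "carrier (integer_mod_group d) = {0..<int d}"
    using d by (simp add: carrier_integer_mod_group)
  have hom: "\<psi> \<in> hom (integer_mod_group d) complex_units"
    using \<psi> by (simp add: irreducible_characters_def)
  have mult: "\<psi> ((x + y) mod int d) = \<psi> x * \<psi> y" if "x \<in> {0..<int d}" "y \<in> {0..<int d}" for x y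
    using hom_mult[OF hom, of x y] that by (simp add: G complex_units_def)
  have "\<psi> 0 \<noteq> 0"
    using hom_in_carrier[OF hom, of 0] by (simp add: complex_units_def)
  then have zero: "\<psi> 0 = 1" using mult[of 0 0] d by simp
  \<comment> \<open>\<open>1 mod int d\<close> lies in the carrier also for \<open>d = 1\<close>,
    where \<open>1\<close> does not.\<close>
  define u where "u = \<psi> (1 mod int d)"
  have step: "\<psi> (int (Suc k) mod int d) = \<psi> (int k) * u" if "k < d" for k
    using mult[of "int k" "1 mod int d"] that d by (simp add: u_def mod_add_right_eq add.commute)
  have pow: "\<psi> (int k) = u ^ k" if "k < d" for k
    using that
  proof (induction k)
    case (Suc k)
    then show ?case using step[of k] by (simp add: mult.commute)
  qed (simp add: zero)
  have "u ^ d = \<psi> (int (Suc (d - 1)) mod int d)"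
    using step[of "d - 1"] pow[of "d - 1"] d by (simp flip: power_Suc2)
  then have "u ^ d = 1" using d zero by simp
  then have "u \<in> (\<lambda>k. cis (2 * pi * real k / real d)) ` {..<d}"
    using Complex.bij_betw_roots_unity[OF d] by (auto simp: bij_betw_def)
  then obtain n where n: "n < d" "u = cis (2 * pi * real n / real d)" by auto
  show ?thesis
  proof (rule that[OF n(1)])
    fix g assume "g \<in> carrier (integer_mod_group d)"
    then have "\<psi> g = u ^ nat g" using pow[of "nat g"] by (simp add: G nat_less_iff)
    then show "\<psi> g = cis (2 * pi * (real n * real_of_int g / real d))"
      using \<open>g \<in> _\<close> by (simp add: n(2) Complex.DeMoivre G mult_ac)
  qed
qed

text \<open>Conjugation negates the angle; adding \<open>g\<close> full turns replaces
  \<open>- n\<close> by \<open>d - n\<close>, so that the index stays a natural number.\<close>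

lemma conj_character_index:
  assumes "0 < d" "n \<le> d" and g: "g \<in> carrier (integer_mod_group d)"
    and \<psi>: "\<And>g. g \<in> carrier (integer_mod_group d) \<Longrightarrow>
      \<psi> g = cis (2 * pi * (real n * real_of_int g / real d))"
  shows "conj_character d \<psi> g = cis (2 * pi * (real (d - n) * real_of_int g / real d))"
proof -
  have "2 * pi * (real (d - n) * real_of_int g / real d) =
      2 * pi * real_of_int g + - (2 * pi * (real n * real_of_int g / real d))"
    using assms(1,2) by (simp add: of_nat_diff field_simps)
  then have "cis (2 * pi * (real (d - n) * real_of_int g / real d)) =
      cis (2 * pi * real_of_int g) * cis (- (2 * pi * (real n * real_of_int g / real d)))"
    by (simp only: cis_mult)
  also have "cis (2 * pi * real_of_int g) = 1" by (rule cis_multiple_2pi) auto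
  finally show ?thesis using g by (simp add: conj_character_def \<psi> cis_cnj)
qed

text \<open>\<open>van\<close> is a set of indices whose eigenspaces are known to vanish; by the hypothesis
  \<open>pairs\<close>, at most one conjugate pair of non-real characters avoids it.\<close>

lemma no_repeating_factorsI:
  fixes \<F> :: "('a curve \<times> (int \<Rightarrow> 'a \<Rightarrow> 'a)) set"
  assumes d: "0 < d"
    and van: "\<And>C \<rho> n \<psi>. (C, \<rho>) \<in> \<F> \<Longrightarrow> van n \<Longrightarrow>
      (\<And>g. g \<in> carrier (integer_mod_group d) \<Longrightarrow>
        \<psi> g = cis (2 * pi * (real n * real_of_int g / real d))) \<Longrightarrow> multiplicity_H0 d C \<rho> \<psi> = 0"
    and pairs: "\<And>a b. a \<in> {1..<d} \<Longrightarrow> b \<in> {1..<d} \<Longrightarrow> a \<noteq> b \<Longrightarrow> a + b \<noteq> d \<Longrightarrow> 2 * a \<noteq> d \<Longrightarrow>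
      2 * b \<noteq> d \<Longrightarrow> van a \<or> van (d - a) \<or> van b \<or> van (d - b)"
  shows "no_repeating_factors d \<F>"
  unfolding no_repeating_factors_def Let_def
proof (intro ballI, unfold case_prod_beta, intro ballI impI)
  fix z :: "'a curve \<times> (int \<Rightarrow> 'a \<Rightarrow> 'a)" and \<psi>1 \<psi>2
  let ?I = "irreducible_characters d - {trivial_character d}"
  let ?m = "multiplicity_H0 d (fst z) (snd z)" and ?bar = "conj_character d"
  let ?ch = "\<lambda>n g. cis (2 * pi * (real n * real_of_int g / real d))"
  let ?G = "carrier (integer_mod_group d)"
  assume z: "z \<in> \<F>" and \<psi>1: "\<psi>1 \<in> ?I" and \<psi>2: "\<psi>2 \<in> ?I"
    and *: "\<psi>2 \<notin> {\<psi>1, ?bar \<psi>1} \<and> ?m \<psi>1 * ?m (?bar \<psi>1) * ?m \<psi>2 * ?m (?bar \<psi>2) \<noteq> 0"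
  have ext: "\<psi> = \<psi>'" if "\<psi> \<in> extensional ?G" "\<psi>' \<in> extensional ?G" "\<And>g. g \<in> ?G \<Longrightarrow> \<psi> g = \<psi>' g" for \<psi> \<psi>'
    using extensionalityI[OF that] .
  have ext_bar: "?bar \<psi> \<in> extensional ?G" for \<psi> by (simp add: conj_character_def)
  have ext12: "\<psi>1 \<in> extensional ?G" "\<psi>2 \<in> extensional ?G"
    using \<psi>1 \<psi>2 by (auto simp: irreducible_characters_def)
  have nz: "n \<noteq> 0" if "\<psi> \<in> ?I" "\<And>g. g \<in> ?G \<Longrightarrow> \<psi> g = ?ch n g" for n \<psi>
  proof
    assume "n = 0"
    then have "\<psi> = trivial_character d"
      using that by (intro ext) (auto simp: trivial_character_def irreducible_characters_def)
    then show False using that(1) by simp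
  qed
  have "\<psi>1 \<in> irreducible_characters d" using \<psi>1 by simp
  then obtain a where a: "a < d" "\<And>g. g \<in> ?G \<Longrightarrow> \<psi>1 g = ?ch a g"
    by (rule irreducible_character_index[OF d]) (rule that)
  have "\<psi>2 \<in> irreducible_characters d" using \<psi>2 by simp
  then obtain b where b: "b < d" "\<And>g. g \<in> ?G \<Longrightarrow> \<psi>2 g = ?ch b g"
    by (rule irreducible_character_index[OF d]) (rule that)
  have a': "?bar \<psi>1 g = ?ch (d - a) g" and b': "?bar \<psi>2 g = ?ch (d - b) g" if "g \<in> ?G" for g
    using conj_character_index[OF d _ that] a b by auto
  have ab: "a \<in> {1..<d}" "b \<in> {1..<d}" using nz[OF \<psi>1 a(2)] nz[OF \<psi>2 b(2)] a(1) b(1) by auto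
  have not_van: "\<not> van n" if "\<And>g. g \<in> ?G \<Longrightarrow> \<psi> g = ?ch n g" "?m \<psi> \<noteq> 0" for n \<psi>
  proof
    assume "van n"
    have "(fst z, snd z) \<in> \<F>" using z by simp
    then have "?m \<psi> = 0" using \<open>van n\<close> that(1) by (rule van)
    then show False using that(2) by simp
  qed
  have "a \<noteq> b" using ext[OF ext12] a(2) b(2) * by auto
  moreover have "a + b \<noteq> d"
  proof
    assume "a + b = d"
    then have "b = d - a" by simp
    then have "\<psi>2 = ?bar \<psi>1" using ext[OF ext12(2) ext_bar] a' b(2) by simp
    then show False using * by simp
  qed
  moreover have "\<not> (van a \<or> van (d - a) \<or> van b \<or> van (d - b))"
    using not_van[OF a(2)] not_van[OF a'] not_van[OF b(2)] not_van[OF b'] * by auto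
  \<comment> \<open>If both characters were nonreal, \<open>pairs\<close> would put one of the four
    indices into \<open>van\<close>, and the product of the multiplicities would be zero.\<close>
  ultimately have half: "2 * a = d \<or> 2 * b = d" using pairs ab by blast
  have self: "?bar \<psi> = \<psi> \<longleftrightarrow> 2 * n = d"
    if "\<psi> \<in> extensional ?G" "n \<in> {1..<d}" "\<And>g. g \<in> ?G \<Longrightarrow> \<psi> g = ?ch n g"
      "\<And>g. g \<in> ?G \<Longrightarrow> ?bar \<psi> g = ?ch (d - n) g" for \<psi> n
  proof
    assume "?bar \<psi> = \<psi>"
    moreover have "1 \<in> ?G" using that(2) by auto
    ultimately have "cis (2 * pi * (real_of_int (int (d - n)) / real d)) =
        cis (2 * pi * (real_of_int (int n) / real d))"
      using that(3)[of 1] that(4)[of 1] by simp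
    then have "int d dvd int (d - n) - int n" by (rule cis_fraction_eq[OF d])
    then have "int d dvd int (d - n) - int n + int d" by simp
    then obtain k where k: "int (d - n) - int n + int d = int d * k"
      unfolding dvd_def by blast
    then have eq: "int d * (2 - k) = 2 * int n" using that(2) by (simp add: of_nat_diff algebra_simps)
    \<comment> \<open>As \<open>0 < n < d\<close>, the multiple \<open>2 n\<close> of
      \<open>d\<close> lies strictly between 0 and \<open>2 d\<close>, so it is
      \<open>d\<close>.\<close>
    then have "0 < int d * (2 - k)" "int d * (2 - k) < int d * 2" using that(2) by auto
    then have "0 < 2 - k" "2 - k < 2" using d by (auto simp: zero_less_mult_iff mult_less_cancel_left)
    then have "k = 1" by linarith
    then show "2 * n = d" using eq by simp
  next
    assume "2 * n = d"
    then have "d - n = n" by simp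
    then show "?bar \<psi> = \<psi>" using ext[OF ext_bar that(1)] that(3,4) by simp
  qed
  have real_iff: "?bar \<psi>1 = \<psi>1 \<longleftrightarrow> 2 * a = d" "?bar \<psi>2 = \<psi>2 \<longleftrightarrow> 2 * b = d"
    by (rule self[OF ext12(1) ab(1) a(2) a'], assumption+)
      (rule self[OF ext12(2) ab(2) b(2) b'], assumption+)
  \<comment> \<open>Both premises fail: by \<open>half\<close> one of the characters is real, and
    two real ones would both have index \<open>d / 2\<close>, against
    \<open>a \<noteq> b\<close>.\<close>
  have "\<not> (\<psi>1 \<noteq> ?bar \<psi>1 \<and> \<psi>2 \<noteq> ?bar \<psi>2)"
    using half real_iff by metis
  moreover have "\<not> (\<psi>1 = ?bar \<psi>1 \<and> \<psi>2 = ?bar \<psi>2)"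
    using real_iff \<open>a \<noteq> b\<close> by auto
  ultimately show "(\<psi>1 \<noteq> ?bar \<psi>1 \<and> \<psi>2 \<noteq> ?bar \<psi>2 \<longrightarrow>
       \<not> lie_group_isomorphic (SU (?m \<psi>1) (?m (?bar \<psi>1))) (SU (?m \<psi>2) (?m (?bar \<psi>2)))) \<and>
      (\<psi>1 = ?bar \<psi>1 \<and> \<psi>2 = ?bar \<psi>2 \<longrightarrow> Sp_real (2 * ?m \<psi>1) \<noteq> Sp_real (2 * ?m \<psi>2))"
    by blast
qed

section \<open>From vanishing eigenspaces to the lists of families\<close>

lemma multiplicity_eq_zero:
  assumes d: "0 < d" and fam: "(C, \<rho>) \<in> covering_family {projective_line} d \<Theta>"
    and \<psi>: "\<And>g. g \<in> carrier (integer_mod_group d) \<Longrightarrow>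
      \<psi> g = cis (2 * pi * (real n * real_of_int g / real d))"
    and deg: "(\<Sum>\<theta>\<leftarrow>\<Theta>. int n * \<theta> mod int d) < 2 * int d"
  shows "multiplicity_H0 d C \<rho> \<psi> = 0"
proof -
  interpret vs: vector_space scale_differential by (rule vector_space_scale_differential)
  obtain \<pi> ps where cov: "cyclic_covering d \<Theta> C \<rho> projective_line \<pi> ps"
    using fam by (auto simp: covering_family_def)
  let ?E = "{\<omega> \<in> holomorphic_differentials C. \<forall>g\<in>carrier (integer_mod_group d).
      pullback_differential C (\<rho> (inv\<^bsub>integer_mod_group d\<^esub> g)) \<omega> = scale_differential (\<psi> g) \<omega>}"
  have "\<omega> = 0" if \<omega>: "\<omega> \<in> ?E" for \<omega>
  proof -
    interpret eigendifferential_line d \<Theta> C \<rho> \<pi> ps n \<psi> \<omega>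
    proof unfold_locales
      show "cyclic_covering d \<Theta> C \<rho> projective_line \<pi> ps" "0 < d" by fact+
      show "\<omega> \<in> holomorphic_differentials C" using \<omega> by simp
      show "pullback_differential C (\<rho> (- g mod int d)) \<omega> = scale_differential (\<psi> g) \<omega>"
        if "g \<in> carrier (integer_mod_group d)" for g
        using \<omega> that by auto
    qed (rule \<psi>)
    show ?thesis using deg by (intro differential_vanishes) (simp add: sum_list_sum_nth atLeast0LessThan)
  qed
  then have "?E \<subseteq> vs.span {}" by (auto simp: vs.span_empty)
  then have "vs.dim ?E = card ({} :: 'a differential set)"
    by (intro vs.dim_unique[where B = "{}"]) (auto simp: vs.independent_empty)
  then show ?thesis by (simp add: multiplicity_H0_def)
qed

text \<open>This form of the criterion can be evaluated by computation. \<open>k\<close> names the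
  one conjugate pair \<open>k\<close>, \<open>d - k\<close> that is exempt from the degree
  condition. For the families of the theorem \<open>k = 1\<close> serves, except for
  \<open>(6, [1, 1, 2, 2])\<close>, where the exempt pair is \<open>2\<close>,
  \<open>4\<close>.\<close>

lemma no_repeating_factors_genus_0:
  assumes "\<forall>(d, \<Theta>)\<in>set xs. 0 < d \<and> (\<exists>k\<in>{1, 2}. list_all (\<lambda>a. 2 * a = d \<or> a = k \<or> a + k = d \<or>
    (\<Sum>\<theta>\<leftarrow>\<Theta>. int a * \<theta> mod int d) < 2 * int d \<or>
    (\<Sum>\<theta>\<leftarrow>\<Theta>. int (d - a) * \<theta> mod int d) < 2 * int d) [1..<d])"
  shows "\<forall>(d, \<Theta>)\<in>set xs. no_repeating_factors d (covering_family {projective_line} d \<Theta>)"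
proof clarify
  fix d \<Theta> assume x: "(d, \<Theta>) \<in> set xs"
  define van where "van = (\<lambda>n. (\<Sum>\<theta>\<leftarrow>\<Theta>. int n * \<theta> mod int d) < 2 * int d)"
  obtain k where d: "0 < d"
    and k: "\<forall>a\<in>set [1..<d]. 2 * a = d \<or> a = k \<or> a + k = d \<or> van a \<or> van (d - a)"
    using assms x unfolding van_def list_all_iff by blast
  show "no_repeating_factors d (covering_family {projective_line} d \<Theta>)"
  proof (rule no_repeating_factorsI[OF d, of _ van])
    fix a b assume "a \<in> {1..<d}" "b \<in> {1..<d}" "a \<noteq> b" "a + b \<noteq> d" "2 * a \<noteq> d" "2 * b \<noteq> d"
    \<comment> \<open>Since \<open>a \<noteq> b\<close> and \<open>a + b \<noteq> d\<close>, the two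
      indices cannot both lie in the exempt pair.\<close>
    then show "van a \<or> van (d - a) \<or> van b \<or> van (d - b)"
      using bspec[OF k, of a] bspec[OF k, of b] by auto
  next
    fix C \<rho> n \<psi>
    assume "(C, \<rho>) \<in> covering_family {projective_line} d \<Theta>" "van n"
      and \<psi>: "\<And>g. g \<in> carrier (integer_mod_group d) \<Longrightarrow>
        \<psi> g = cis (2 * pi * (real n * real_of_int g / real d))"
    then show "multiplicity_H0 d C \<rho> \<psi> = 0"
      unfolding van_def by (intro multiplicity_eq_zero[OF d _ \<psi>])
  qed
qed

text \<open>The nonreal indices are \<open>1, 2\<close> for \<open>d = 3\<close> and
  \<open>1, 3\<close> for \<open>d = 4\<close>, a single conjugate pair, and there are none for
  \<open>d = 2\<close>. So \<open>van\<close> can be taken empty, whatever the family.\<close>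

lemma no_repeating_factors_small:
  assumes "\<forall>(d, \<Theta>)\<in>set xs. d \<in> {2, 3, 4}"
  shows "\<forall>(d, \<Theta>)\<in>set xs. no_repeating_factors d (\<F> d \<Theta>)"
proof clarify
  fix d \<Theta> assume "(d, \<Theta>) \<in> set xs"
  then have d: "d = 2 \<or> d = 3 \<or> d = 4" using assms by auto
  show "no_repeating_factors d (\<F> d \<Theta>)"
  proof (rule no_repeating_factorsI[of _ _ "\<lambda>_. False"])
    fix a b assume ab: "a \<in> {1..<d}" "b \<in> {1..<d}" "a \<noteq> b" "a + b \<noteq> d" "2 * a \<noteq> d" "2 * b \<noteq> d"
    have "x = 1 \<or> x = 2 \<or> x = 3" if "x \<in> {1..<d}" for x
      using that d by auto
    from this[OF ab(1)] this[OF ab(2)] show "False \<or> False \<or> False \<or> False"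
      using ab d by auto
  next
    show "0 < d" using d by auto
  qed simp
qed

theorem theorem5p8:
  shows "(\<forall>(d, \<Theta>) \<in> set
      [(2, [1, 1, 1, 1]),
       (2, [1, 1, 1, 1, 1, 1]),
       (3, [1, 1, 2, 2]),
       (4, [1, 2, 2, 3]),
       (6, [2, 3, 3, 4]),
       (3, [1, 1, 1, 1, 2]),
       (4, [1, 1, 1, 1]),
       (4, [1, 1, 2, 2, 2]),
       (6, [1, 3, 4, 4]),
       (3, [1, 1, 1, 1, 1, 1]),
       (5, [1, 3, 3, 3]),
       (6, [1, 1, 1, 3]),
       (6, [1, 1, 2, 2]),
       (6, [2, 2, 2, 3, 3]),
       (8, [2, 4, 5, 5]),
       (5, [2, 2, 2, 2, 2]),
       (7, [2, 4, 4, 4]),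
       (10, [3, 5, 6, 6]),
       (9, [3, 5, 5, 5]),
       (12, [4, 6, 7, 7])].
      no_repeating_factors d
        (covering_family {projective_line} d \<Theta> :: ('a curve \<times> (int \<Rightarrow> 'a \<Rightarrow> 'a)) set))
    \<and>
    (\<forall>(d, \<Theta>) \<in> set
      [(2, [1, 1]),
       (2, [1, 1, 1, 1]),
       (3, [1, 2]),
       (3, [1, 1, 1]),
       (4, [2, 2])].
      no_repeating_factors d
        (covering_family (curves_of_genus 1 :: 'b curve set) d \<Theta>
           :: ('a curve \<times> (int \<Rightarrow> 'a \<Rightarrow> 'a)) set))"
proof (rule conjI, goal_cases)
  case 1
  \<comment> \<open>Simplification computes the residue sums of all listed families for every index
    below \<open>d\<close>.\<close>
  show ?case by (rule no_repeating_factors_genus_0) (simp add: upt_conv_Cons)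
next
  case 2
  show ?case by (rule no_repeating_factors_small) simp
qed

end
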